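(* Let $\lambda_m,c_m$ and $\lambda_s,c_s$ be the time and space constants of given middle product and short product algorithms, and let $c=\max(c_m+3,c_s+2)$. In the memory model where the input dividend $F$ may be overwritten (erased), there is an algorithm which, given $F,G\in\mathbb{K}[X]$ of size $n$ such that the constant coefficient of $G$ is invertible, computes the polynomial $Q\in\mathbb{K}[X]$ of size $n$ such that $F/G=Q\bmod X^n$, using $O(1)$ extra space and $$\left(\lambda_m\Big(\frac{c+1}{2}+\frac1c\Big)+\lambda_s\Big(1+\frac1c\Big)\right)\mathsf{M}(n)+O(n)$$ operations in $\mathbb{K}$.
   Context: Model. $\mathbb{K}$ is the coefficient ring (commutative with unit). A size-$n$ polynomial is a polynomial of degree at most $n-1$, stored by its $n$ coefficients, one per register. A register may contain either an element of $\mathbb{K}$ or a pointer to the input or output space. The input space is read-only, except that here the registers of the dividend $F$ may be read and overwritten; the output space is pre-allocated and its registers may be read and written any number of times. The (extra) space of an algorithm is the number of registers used besides the input and output registers. Time is the number of arithmetic operations in $\mathbb{K}$. Underlying products. $\mathsf{M}(n)$ is a bound on the number of operations in $\mathbb{K}$ to multiply two size-$n$ polynomials, with $\alpha\mathsf{M}(n)\le\mathsf{M}(\alpha n)$ for any constant $\alpha\ge 1$. The middle product of a size-$(m+n-1)$ polynomial $F$ and a size-$n$ polynomial $G$ is the size-$m$ polynomial $\mathsf{MP}(F,G)=(FG \operatorname{div} X^{n-1})\bmod X^m$; $\lambda_m\mathsf{M}(n)$ and $c_m n$ denote the time and extra space of middle products of size $(2n-1,n)$; a middle product in size $(m+n-1,n)$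 with $m<n$ then costs $\lceil n/m\rceil\lambda_m\mathsf{M}(m)$ operations and $(c_m+1)m$ extra space. The short product of two size-$n$ polynomials is $\mathsf{SP}(F,G)=FG\bmod X^n$, with time $\lambda_s\mathsf{M}(n)$ and extra space $c_s n$. It is known (Newton iteration) that power series inversion at precision $n$ can be done in $(\lambda_m+\lambda_s)\mathsf{M}(n)$ operations with $\frac12\max(c_m,c_s+1)n$ extra space. *)

theory Defs
  imports Complex_Main "HOL-Computational_Algebra.Polynomial_FPS"
begin

section \<open>Division and products of polynomials over a commutative ring\<close>

text \<open>
  The library's \<open>div\<close> is not available over an arbitrary commutative ring.  The quotient below is
  used for units \<open>y\<close> only, where it is well defined (\<open>unit_quotient_eq\<close>); it serves both for the
  ring of coefficients and for power series.
\<close>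

definition unit_quotient :: "'a::comm_ring_1 \<Rightarrow> 'a \<Rightarrow> 'a" where
  "unit_quotient x y = (THE z. y * z = x)"

lemma unit_quotient_eq:
  assumes "y dvd 1"
  shows "unit_quotient x y = z \<longleftrightarrow> y * z = x"
proof -
  obtain u where u: "1 = y * u" using assms by (auto elim: dvdE)
  have cancel: "a = b" if "y * a = y * b" for a b
  proof -
    have "u * (y * a) = u * (y * b)" using that by simp
    then show ?thesis using u by (metis mult.assoc mult.commute mult_1)
  qed
  have sol: "y * (u * x) = x" using u by (metis mult.assoc mult_1)
  have "unit_quotient x y = u * x"
    unfolding unit_quotient_def by (rule the_equality) (use sol cancel in auto)
  then show ?thesis using sol cancel by auto
qed

lemma fps_of_poly_dvd_1:
  fixes G :: "'a::comm_ring_1 poly"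
  assumes "coeff G 0 dvd 1"
  shows "fps_of_poly G dvd 1"
proof -
  obtain u where "1 = coeff G 0 * u" using assms by (auto elim: dvdE)
  then have "fps_of_poly G * fps_right_inverse (fps_of_poly G) u = 1"
    by (intro fps_right_inverse) simp
  then show ?thesis by (metis dvd_triv_left)
qed

text \<open>The \<open>Q\<close> of size \<open>n\<close> with \<open>F / G = Q mod X\<^sup>n\<close>, where \<open>F / G\<close> is a power series.\<close>

definition series_quotient :: "nat \<Rightarrow> 'a::comm_ring_1 poly \<Rightarrow> 'a poly \<Rightarrow> 'a poly" where
  "series_quotient n F G = truncate_fps n (unit_quotient (fps_of_poly F) (fps_of_poly G))"

text \<open>\<open>poly_shift k\<close> is \<open>div X\<^sup>k\<close> and \<open>poly_cutoff k\<close> is \<open>mod X\<^sup>k\<close>.\<close>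

definition middle_product :: "nat \<Rightarrow> nat \<Rightarrow> 'a::comm_ring_1 poly \<Rightarrow> 'a poly \<Rightarrow> 'a poly" where
  "middle_product m n F G = poly_cutoff m (poly_shift (n - 1) (F * G))"

definition short_product :: "nat \<Rightarrow> 'a::comm_ring_1 poly \<Rightarrow> 'a poly \<Rightarrow> 'a poly" where
  "short_product n F G = poly_cutoff n (F * G)"


section \<open>The memory model\<close>

text \<open>
  The machine has two input spaces, an output space and a work space, each of them an array of
  registers.  A register holds an element of the coefficient ring or a pointer.  A pointer is stored
  as an offset: the space it refers to is named by the instruction that dereferences it.

  Work registers may be addressed indirectly as well, since otherwise a fixed program could not
  use a number of them that grows with the size of the input.
\<close>

datatype space = Arg1 | Arg2 | Out | Work

datatype 'k cell = Coef 'k | Ptr nat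

type_synonym 'k mem = "space \<times> nat \<Rightarrow> 'k cell"

text \<open>
  \<open>psize\<close> is the size parameter \<open>n\<close> of the problem instance, which programs may consult; \<open>len\<close> gives
  the number of registers of each space, and \<open>writable\<close> the spaces that are not read-only.
\<close>

record layout =
  psize :: nat
  len :: "space \<Rightarrow> nat"
  writable :: "space set"

text \<open>
  A stored pointer may not exceed the total number of registers.  Without a bound, a single
  register could hold an unbounded amount of data.
\<close>

definition ptr_bound :: "layout \<Rightarrow> nat" where
  "ptr_bound L = len L Arg1 + len L Arg2 + len L Out + len L Work"

datatype pop = PPlus | PMinus | PTimes | PDiv

datatype pexp = Size | Num nat | Deref space pexp | PBin pop pexp pexp

datatype addr = Addr space pexp

datatype kop = KPlus | KMinus | KTimes | KDiv

text \<open>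
  Elements of the ring can be copied, combined by arithmetic operations, and loaded from finitely
  many constants that occur in the program.  There are no tests on ring elements: control depends on
  pointers only.
\<close>

datatype 'k instr =
    Load addr 'k
  | Point addr pexp
  | Move addr addr
  | Arith addr kop addr addr

text \<open>\<open>Cond e1 e2\<close> and \<open>Loop e1 e2\<close> test \<open>e1 < e2\<close>.\<close>

datatype 'k prog =
    Skip
  | Do "'k instr"
  | Seq "'k prog" "'k prog"
  | Cond pexp pexp "'k prog" "'k prog"
  | Loop pexp pexp "'k prog"

fun pop_apply :: "pop \<Rightarrow> nat \<Rightarrow> nat \<Rightarrow> nat" where
  "pop_apply PPlus a b = a + b"
| "pop_apply PMinus a b = a - b"
| "pop_apply PTimes a b = a * b"
| "pop_apply PDiv a b = a div b"

fun kop_apply :: "kop \<Rightarrow> 'k::comm_ring_1 \<Rightarrow> 'k \<Rightarrow> 'k option" where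
  "kop_apply KPlus x y = Some (x + y)"
| "kop_apply KMinus x y = Some (x - y)"
| "kop_apply KTimes x y = Some (x * y)"
| "kop_apply KDiv x y = (if y dvd 1 then Some (unit_quotient x y) else None)"

fun as_ptr :: "'k cell \<Rightarrow> nat option" where
  "as_ptr (Ptr p) = Some p"
| "as_ptr (Coef x) = None"

fun as_coef :: "'k cell \<Rightarrow> 'k option" where
  "as_coef (Coef x) = Some x"
| "as_coef (Ptr p) = None"

text \<open>
  \<open>None\<close> stands for a run-time error: an access outside the allotted registers, a write to a read-only
  space, a pointer where a ring element is expected or vice versa, a pointer that is too large, or a
  division by a non-unit.
\<close>

fun peval :: "layout \<Rightarrow> 'k mem \<Rightarrow> pexp \<Rightarrow> nat option" where
  "peval L \<mu> Size = Some (psize L)"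
| "peval L \<mu> (Num k) = Some k"
| "peval L \<mu> (Deref sp e) =
     Option.bind (peval L \<mu> e) (\<lambda>i. if i < len L sp then as_ptr (\<mu> (sp, i)) else None)"
| "peval L \<mu> (PBin f e1 e2) =
     Option.bind (peval L \<mu> e1) (\<lambda>a. Option.bind (peval L \<mu> e2) (\<lambda>b. Some (pop_apply f a b)))"

fun locate :: "layout \<Rightarrow> 'k mem \<Rightarrow> addr \<Rightarrow> (space \<times> nat) option" where
  "locate L \<mu> (Addr sp e) =
     Option.bind (peval L \<mu> e) (\<lambda>i. if i < len L sp then Some (sp, i) else None)"

definition fetch :: "layout \<Rightarrow> 'k mem \<Rightarrow> addr \<Rightarrow> 'k cell option" where
  "fetch L \<mu> a = map_option \<mu> (locate L \<mu> a)"

definition store :: "layout \<Rightarrow> 'k mem \<Rightarrow> addr \<Rightarrow> 'k cell \<Rightarrow> 'k mem option" where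
  "store L \<mu> a v =
     Option.bind (locate L \<mu> a) (\<lambda>l. if fst l \<in> writable L then Some (\<mu>(l := v)) else None)"

fun step :: "layout \<Rightarrow> 'k::comm_ring_1 instr \<Rightarrow> 'k mem \<Rightarrow> 'k mem option" where
  "step L (Load d x) \<mu> = store L \<mu> d (Coef x)"
| "step L (Point d e) \<mu> =
     Option.bind (peval L \<mu> e) (\<lambda>p. if p \<le> ptr_bound L then store L \<mu> d (Ptr p) else None)"
| "step L (Move d a) \<mu> = Option.bind (fetch L \<mu> a) (store L \<mu> d)"
| "step L (Arith d f a b) \<mu> =
     Option.bind (Option.bind (fetch L \<mu> a) as_coef) (\<lambda>x.
     Option.bind (Option.bind (fetch L \<mu> b) as_coef) (\<lambda>y.
     Option.bind (kop_apply f x y) (\<lambda>z. store L \<mu> d (Coef z))))"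

text \<open>Only operations in the coefficient ring take time.\<close>

fun cost :: "'k instr \<Rightarrow> nat" where
  "cost (Arith d f a b) = 1"
| "cost (Load d x) = 0"
| "cost (Point d e) = 0"
| "cost (Move d a) = 0"

text \<open>\<open>exec L P \<mu> t \<mu>'\<close>: started in \<open>\<mu>\<close>, the program \<open>P\<close> terminates without error in \<open>\<mu>'\<close> after \<open>t\<close>
  arithmetic operations.\<close>

inductive exec ::
  "layout \<Rightarrow> 'k::comm_ring_1 prog \<Rightarrow> 'k mem \<Rightarrow> nat \<Rightarrow> 'k mem \<Rightarrow> bool" for L where
  exec_Skip: "exec L Skip \<mu> 0 \<mu>"
| exec_Do: "step L i \<mu> = Some \<mu>' \<Longrightarrow> exec L (Do i) \<mu> (cost i) \<mu>'"
| exec_Seq: "exec L P \<mu> s \<mu>' \<Longrightarrow> exec L Q \<mu>' t \<mu>'' \<Longrightarrow> exec L (Seq P Q) \<mu> (s + t) \<mu>''"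
| exec_Cond_True:
    "peval L \<mu> e1 = Some a \<Longrightarrow> peval L \<mu> e2 = Some b \<Longrightarrow> a < b \<Longrightarrow> exec L P \<mu> t \<mu>' \<Longrightarrow>
     exec L (Cond e1 e2 P Q) \<mu> t \<mu>'"
| exec_Cond_False:
    "peval L \<mu> e1 = Some a \<Longrightarrow> peval L \<mu> e2 = Some b \<Longrightarrow> \<not> a < b \<Longrightarrow> exec L Q \<mu> t \<mu>' \<Longrightarrow>
     exec L (Cond e1 e2 P Q) \<mu> t \<mu>'"
| exec_Loop_True:
    "peval L \<mu> e1 = Some a \<Longrightarrow> peval L \<mu> e2 = Some b \<Longrightarrow> a < b \<Longrightarrow> exec L P \<mu> s \<mu>' \<Longrightarrow>
     exec L (Loop e1 e2 P) \<mu>' t \<mu>'' \<Longrightarrow> exec L (Loop e1 e2 P) \<mu> (s + t) \<mu>''"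
| exec_Loop_False:
    "peval L \<mu> e1 = Some a \<Longrightarrow> peval L \<mu> e2 = Some b \<Longrightarrow> \<not> a < b \<Longrightarrow>
     exec L (Loop e1 e2 P) \<mu> 0 \<mu>"

inductive_cases exec_SkipE: "exec L Skip \<mu> t \<mu>'"
inductive_cases exec_DoE: "exec L (Do i) \<mu> t \<mu>'"
inductive_cases exec_SeqE: "exec L (Seq P Q) \<mu> t \<mu>'"
inductive_cases exec_CondE: "exec L (Cond e1 e2 P Q) \<mu> t \<mu>'"
inductive_cases exec_LoopE: "exec L (Loop e1 e2 P) \<mu> t \<mu>'"

text \<open>Execution is deterministic, so the existence of a run expresses total correctness.\<close>

lemma exec_deterministic:
  "exec L P \<mu> t \<mu>1 \<Longrightarrow> exec L P \<mu> s \<mu>2 \<Longrightarrow> t = s \<and> \<mu>1 = \<mu>2"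
proof (induction arbitrary: s \<mu>2 rule: exec.induct)
  case exec_Skip
  then show ?case by (auto elim: exec_SkipE)
next
  case exec_Do
  then show ?case by (auto elim: exec_DoE)
next
  case (exec_Seq P \<mu> s \<mu>' Q t \<mu>'')
  from exec_Seq.prems show ?case
    by (rule exec_SeqE) (metis exec_Seq.IH)
next
  case exec_Cond_True
  from exec_Cond_True.prems show ?case
    by (rule exec_CondE; intro exec_Cond_True.IH) (use exec_Cond_True.hyps in auto)
next
  case exec_Cond_False
  from exec_Cond_False.prems show ?case
    by (rule exec_CondE; intro exec_Cond_False.IH) (use exec_Cond_False.hyps in auto)
next
  case (exec_Loop_True \<mu> e1 a e2 b P s \<mu>' t \<mu>'')
  from exec_Loop_True.prems show ?case
    by (rule exec_LoopE) (use exec_Loop_True.hyps in \<open>(metis exec_Loop_True.IH | simp)+\<close>)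
next
  case exec_Loop_False
  from exec_Loop_False.prems show ?case
    by (rule exec_LoopE) (use exec_Loop_False.hyps in auto)
qed


section \<open>Algorithms on polynomials\<close>

definition holds_poly :: "'k::comm_ring_1 mem \<Rightarrow> space \<Rightarrow> nat \<Rightarrow> 'k poly \<Rightarrow> bool" where
  "holds_poly \<mu> sp n p \<longleftrightarrow> (\<forall>i<n. \<mu> (sp, i) = Coef (coeff p i))"

fun space_lens :: "nat \<Rightarrow> nat \<Rightarrow> nat \<Rightarrow> nat \<Rightarrow> space \<Rightarrow> nat" where
  "space_lens a b r w Arg1 = a"
| "space_lens a b r w Arg2 = b"
| "space_lens a b r w Out = r"
| "space_lens a b r w Work = w"

text \<open>
  With \<open>n\<close> as size parameter, inputs \<open>A\<close>, \<open>B\<close> of sizes \<open>a\<close>, \<open>b\<close> and \<open>w\<close> extra registers,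
  the program \<open>P\<close> writes \<open>R\<close>, of size \<open>r\<close>, to the output space using at most \<open>T\<close> arithmetic operations.
  The output and extra registers initially have arbitrary contents.
\<close>

definition computes ::
  "space set \<Rightarrow> 'k::comm_ring_1 prog \<Rightarrow> nat \<Rightarrow> nat \<Rightarrow> nat \<Rightarrow> nat \<Rightarrow> nat \<Rightarrow>
   'k poly \<Rightarrow> 'k poly \<Rightarrow> 'k poly \<Rightarrow> real \<Rightarrow> bool" where
  "computes W P n a b r w A B R T \<longleftrightarrow>
     (\<forall>\<mu>. holds_poly \<mu> Arg1 a A \<and> holds_poly \<mu> Arg2 b B \<longrightarrow>
        (\<exists>t \<mu>'. exec \<lparr>psize = n, len = space_lens a b r w, writable = W\<rparr> P \<mu> t \<mu>' \<and>
               holds_poly \<mu>' Out r R \<and> real t \<le> T))"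

text \<open>\<open>M\<close> bounds the time of multiplication; no restriction is put on the space.  The number
  \<open>\<alpha>\<close> ranges over the reals such that \<open>\<alpha> n\<close> is a size.\<close>

definition mult_time_bound :: "'k::comm_ring_1 itself \<Rightarrow> (nat \<Rightarrow> real) \<Rightarrow> bool" where
  "mult_time_bound TYPE('k) M \<longleftrightarrow>
     (\<exists>(P :: 'k prog) w. \<forall>n\<ge>1. \<forall>F G. degree F < n \<and> degree G < n \<longrightarrow>
        computes {Out, Work} P n n n (2 * n - 1) (w n) F G (F * G) (M n))
     \<and> (\<forall>(\<alpha>::real) n m. \<alpha> \<ge> 1 \<and> n \<ge> 1 \<and> real m = \<alpha> * real n \<longrightarrow> \<alpha> * M n \<le> M m)"

text \<open>
  \<open>P\<close> computes middle products of size \<open>(2 n - 1, n)\<close> in time \<open>lam_m M(n)\<close> and extra space \<open>cm n\<close>.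
  Space is understood up to an additive constant: every program whose running time grows needs some
  registers for its pointers, so \<open>cm = 0\<close> has to mean constant extra space.
\<close>

definition middle_product_algorithm ::
  "(nat \<Rightarrow> real) \<Rightarrow> real \<Rightarrow> real \<Rightarrow> 'k::comm_ring_1 prog \<Rightarrow> bool" where
  "middle_product_algorithm M lam_m cm P \<longleftrightarrow>
     (\<exists>w (d::real). (\<forall>n\<ge>1. real (w n) \<le> cm * real n + d) \<and>
        (\<forall>n\<ge>1. \<forall>F G. degree F < 2 * n - 1 \<and> degree G < n \<longrightarrow>
           computes {Out, Work} P n (2 * n - 1) n n (w n) F G (middle_product n n F G) (lam_m * M n)))"

definition short_product_algorithm ::
  "(nat \<Rightarrow> real) \<Rightarrow> real \<Rightarrow> real \<Rightarrow> 'k::comm_ring_1 prog \<Rightarrow> bool" where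
  "short_product_algorithm M lam_s cs P \<longleftrightarrow>
     (\<exists>w (d::real). (\<forall>n\<ge>1. real (w n) \<le> cs * real n + d) \<and>
        (\<forall>n\<ge>1. \<forall>F G. degree F < n \<and> degree G < n \<longrightarrow>
           computes {Out, Work} P n n n n (w n) F G (short_product n F G) (lam_s * M n)))"

text \<open>
  The dividend is in \<open>Arg1\<close>, which may be overwritten; the divisor in \<open>Arg2\<close> is read-only.  The number
  \<open>w\<close> of extra registers does not depend on \<open>n\<close>.
\<close>

definition erasing_division_algorithm ::
  "nat \<Rightarrow> (nat \<Rightarrow> real) \<Rightarrow> 'k::comm_ring_1 prog \<Rightarrow> bool" where
  "erasing_division_algorithm w T P \<longleftrightarrow>
     (\<forall>n\<ge>1. \<forall>F G. degree F < n \<and> degree G < n \<and> coeff G 0 dvd 1 \<longrightarrow>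
        computes {Arg1, Out, Work} P n n n n w F G (series_quotient n F G) (T n))"

end

theory Submission
  imports Defs
begin

text \<open>
  Let \<open>h\<close> be an integer between \<open>c + 1\<close> and \<open>c + 2\<close>, and let \<open>K = n div h\<close>.  Each block of \<open>K\<close> coefficients
  of the quotient is the short product of the corresponding block of the current dividend with
  \<open>U = 1 / G mod X\<^sup>K\<close>; it replaces that block of the dividend, and its contribution to the later blocks
  is subtracted by middle products with windows of \<open>G\<close>.  All live data thus stays in the space of the
  dividend, and the whole output space is a free contiguous array of \<open>n\<close> registers.  There the
  first \<open>K\<close> registers hold \<open>U\<close>, the next \<open>K\<close> the result of the current product, and the remaining
  \<open>(h - 2) K \<ge> (c - 1) K\<close> serve as work space for the product algorithms.  Since these all occupy a
  contiguous array, the product algorithms can be run by a mere renaming of spaces and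
  shift of addresses.

  The inverse \<open>U\<close> is computed by Newton iteration with the precisions \<open>K div 2^j\<close>; when such a
  precision is odd, its last coefficient is computed naively, so that the costs still
  add up to at most that of precision \<open>K\<close>.  The last \<open>n - h K < h\<close> coefficients of the quotient, as well as
  all coefficients for small \<open>n\<close>, are computed naively.  There are \<open>h (h - 1) / 2\<close> middle products and \<open>h\<close> short
  products, all of size \<open>K \<le> n / h\<close>.
\<close>

section \<open>Programs and their execution\<close>

text \<open>The clock reading \<open>t\<close> at the start is threaded through, so that
  postconditions speak of the total time. As execution is deterministic, the existence of a run is
  total correctness.\<close>

definition runs ::
  "layout \<Rightarrow> 'k::comm_ring_1 prog \<Rightarrow> nat \<Rightarrow> 'k mem \<Rightarrow> (nat \<Rightarrow> 'k mem \<Rightarrow> bool) \<Rightarrow> bool" where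
  "runs L P t \<mu> Q \<longleftrightarrow> (\<exists>s \<mu>'. exec L P \<mu> s \<mu>' \<and> Q (t + s) \<mu>')"

lemma runs_mono: "runs L P t \<mu> Q \<Longrightarrow> (\<And>t' \<mu>'. Q t' \<mu>' \<Longrightarrow> R t' \<mu>') \<Longrightarrow> runs L P t \<mu> R"
  unfolding runs_def by blast

lemma runs_Skip: "Q t \<mu> \<Longrightarrow> runs L Skip t \<mu> Q"
  unfolding runs_def using exec_Skip by (metis add.right_neutral)

lemma runs_Do: "step L i \<mu> = Some \<mu>' \<Longrightarrow> Q (t + cost i) \<mu>' \<Longrightarrow> runs L (Do i) t \<mu> Q"
  unfolding runs_def using exec_Do by blast

lemma runs_Seq:
  assumes "runs L P t \<mu> Q" "\<And>t' \<mu>'. Q t' \<mu>' \<Longrightarrow> runs L P' t' \<mu>' R"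
  shows "runs L (Seq P P') t \<mu> R"
proof -
  obtain s \<mu>' where s: "exec L P \<mu> s \<mu>'" "Q (t + s) \<mu>'"
    using assms(1) unfolding runs_def by blast
  then obtain s' \<mu>'' where s': "exec L P' \<mu>' s' \<mu>''" "R (t + s + s') \<mu>''"
    using assms(2) unfolding runs_def by blast
  show ?thesis
    unfolding runs_def using exec_Seq[OF s(1) s'(1)] s'(2) by (auto simp: add.assoc)
qed

lemma runs_Do_Seq:
  "step L i \<mu> = Some \<mu>' \<Longrightarrow> runs L P (t + cost i) \<mu>' Q \<Longrightarrow> runs L (Seq (Do i) P) t \<mu> Q"
  by (rule runs_Seq[where Q = "\<lambda>t' \<nu>. t' = t + cost i \<and> \<nu> = \<mu>'"]) (auto intro: runs_Do)

lemma runs_Cond: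
  assumes "peval L \<mu> e1 = Some a" "peval L \<mu> e2 = Some b"
    and "a < b \<Longrightarrow> runs L P t \<mu> Q" "\<not> a < b \<Longrightarrow> runs L P' t \<mu> Q"
  shows "runs L (Cond e1 e2 P P') t \<mu> Q"
  using assms exec_Cond_True[OF assms(1,2)] exec_Cond_False[OF assms(1,2)]
  unfolding runs_def by (cases "a < b") blast+

text \<open>The invariant carries an index that rises by one per round up to \<open>N\<close>;
  induction on \<open>N - v\<close> yields termination and the final invariant together.\<close>

lemma runs_Loop:
  fixes P :: "'k::comm_ring_1 prog"
  assumes "I v t \<mu>" "v \<le> N"
    and body: "\<And>v t \<mu>. v < N \<Longrightarrow> I v t \<mu> \<Longrightarrow>
      (\<exists>a b. peval L \<mu> e1 = Some a \<and> peval L \<mu> e2 = Some b \<and> a < b) \<and> runs L P t \<mu> (I (Suc v))"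
    and exit: "\<And>t \<mu>. I N t \<mu> \<Longrightarrow> \<exists>a b. peval L \<mu> e1 = Some a \<and> peval L \<mu> e2 = Some b \<and> \<not> a < b"
  shows "runs L (Loop e1 e2 P) t \<mu> (I N)"
  using assms(1,2)
proof (induction "N - v" arbitrary: v t \<mu>)
  case 0
  then have "v = N" by simp
  with 0 have "I N t \<mu>" by simp
  with exit obtain a b where "peval L \<mu> e1 = Some a" "peval L \<mu> e2 = Some b" "\<not> a < b" by blast
  from exec_Loop_False[OF this] \<open>I N t \<mu>\<close> show ?case
    unfolding runs_def by force
next
  case (Suc d)
  then have v: "v < N" by simp
  from body[OF v Suc.prems(1)] obtain a b where g: "peval L \<mu> e1 = Some a" "peval L \<mu> e2 = Some b" "a < b"
    and r: "runs L P t \<mu> (I (Suc v))" by blast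
  from r obtain s \<mu>' where s: "exec L P \<mu> s \<mu>'" "I (Suc v) (t + s) \<mu>'"
    unfolding runs_def by blast
  from Suc.hyps(1)[OF _ s(2)] Suc.hyps(2) v have "runs L (Loop e1 e2 P) (t + s) \<mu>' (I N)" by simp
  then obtain s' \<mu>'' where s': "exec L (Loop e1 e2 P) \<mu>' s' \<mu>''" "I N (t + s + s') \<mu>''"
    unfolding runs_def by blast
  show ?case
    unfolding runs_def
    using exec_Loop_True[OF g s(1) s'(1)] s'(2) by (auto simp: add.assoc)
qed

section \<open>Running a program inside another memory\<close>

text \<open>The translated program runs in a memory where each space \<open>sp\<close> is the part of the space \<open>S sp\<close> from
  the offset \<open>b sp\<close> on, and the size parameter is the value of \<open>z\<close>.\<close>

fun tr_pexp :: "pexp \<Rightarrow> (space \<Rightarrow> space) \<Rightarrow> (space \<Rightarrow> pexp) \<Rightarrow> pexp \<Rightarrow> pexp" where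
  "tr_pexp z S b Size = z"
| "tr_pexp z S b (Num k) = Num k"
| "tr_pexp z S b (Deref sp e) = Deref (S sp) (PBin PPlus (b sp) (tr_pexp z S b e))"
| "tr_pexp z S b (PBin f e1 e2) = PBin f (tr_pexp z S b e1) (tr_pexp z S b e2)"

fun tr_addr :: "pexp \<Rightarrow> (space \<Rightarrow> space) \<Rightarrow> (space \<Rightarrow> pexp) \<Rightarrow> addr \<Rightarrow> addr" where
  "tr_addr z S b (Addr sp e) = Addr (S sp) (PBin PPlus (b sp) (tr_pexp z S b e))"

fun tr_instr :: "pexp \<Rightarrow> (space \<Rightarrow> space) \<Rightarrow> (space \<Rightarrow> pexp) \<Rightarrow> 'k instr \<Rightarrow> 'k instr" where
  "tr_instr z S b (Load d x) = Load (tr_addr z S b d) x"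
| "tr_instr z S b (Point d e) = Point (tr_addr z S b d) (tr_pexp z S b e)"
| "tr_instr z S b (Move d a) = Move (tr_addr z S b d) (tr_addr z S b a)"
| "tr_instr z S b (Arith d f a a') =
     Arith (tr_addr z S b d) f (tr_addr z S b a) (tr_addr z S b a')"

fun tr_prog :: "pexp \<Rightarrow> (space \<Rightarrow> space) \<Rightarrow> (space \<Rightarrow> pexp) \<Rightarrow> 'k prog \<Rightarrow> 'k prog" where
  "tr_prog z S b Skip = Skip"
| "tr_prog z S b (Do i) = Do (tr_instr z S b i)"
| "tr_prog z S b (Seq P Q) = Seq (tr_prog z S b P) (tr_prog z S b Q)"
| "tr_prog z S b (Cond e1 e2 P Q) =
     Cond (tr_pexp z S b e1) (tr_pexp z S b e2) (tr_prog z S b P) (tr_prog z S b Q)"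
| "tr_prog z S b (Loop e1 e2 P) =
     Loop (tr_pexp z S b e1) (tr_pexp z S b e2) (tr_prog z S b P)"

lemma cost_tr_instr [simp]: "cost (tr_instr z S b i) = cost i"
  by (cases i) auto

definition target :: "layout \<Rightarrow> (space \<Rightarrow> space) \<Rightarrow> (space \<Rightarrow> nat) \<Rightarrow> (space \<times> nat) set" where
  "target L' S b = {(S sp, b sp + i) | sp i. sp \<in> writable L' \<and> i < len L' sp}"

text \<open>The host recomputes the size and the offsets at every access, so they must keep their
  values in all memories that differ from \<open>\<mu>0\<close> only in \<open>target\<close>, the
  registers the guest may write. Injectivity concerns pairs with a writable member: a write must
  reach exactly one guest register, whereas read-only windows may overlap. The last assumption lets
  the host store every pointer of the guest.\<close>

locale embedding =
  fixes L L' :: layout and z :: pexp and S :: "space \<Rightarrow> space" and be :: "space \<Rightarrow> pexp"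
    and b :: "space \<Rightarrow> nat" and \<mu>0 :: "'k::comm_ring_1 mem"
  assumes size: "\<And>\<mu>. (\<And>l. l \<notin> target L' S b \<Longrightarrow> \<mu> l = \<mu>0 l) \<Longrightarrow> peval L \<mu> z = Some (psize L')"
    and base: "\<And>\<mu> sp. (\<And>l. l \<notin> target L' S b \<Longrightarrow> \<mu> l = \<mu>0 l) \<Longrightarrow> peval L \<mu> (be sp) = Some (b sp)"
    and range: "\<And>sp i. i < len L' sp \<Longrightarrow> b sp + i < len L (S sp)"
    and wr: "\<And>sp. sp \<in> writable L' \<Longrightarrow> S sp \<in> writable L"
    and inj: "\<And>sp i sp' i'. sp \<in> writable L' \<Longrightarrow> i < len L' sp \<Longrightarrow> i' < len L' sp' \<Longrightarrow>
      S sp = S sp' \<Longrightarrow> b sp + i = b sp' + i' \<Longrightarrow> sp = sp' \<and> i = i'"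
    and bound: "ptr_bound L' \<le> ptr_bound L"
begin

definition sim :: "'k mem \<Rightarrow> 'k mem \<Rightarrow> bool" where
  "sim \<nu> \<mu> \<longleftrightarrow> (\<forall>l. l \<notin> target L' S b \<longrightarrow> \<mu> l = \<mu>0 l) \<and>
     (\<forall>sp i. i < len L' sp \<longrightarrow> \<mu> (S sp, b sp + i) = \<nu> (sp, i))"

lemma peval_tr:
  assumes "sim \<nu> \<mu>" "peval L' \<nu> e = Some a"
  shows "peval L \<mu> (tr_pexp z S be e) = Some a"
  using assms(2)
proof (induction e arbitrary: a)
  case Size
  then show ?case using assms(1) size unfolding sim_def by auto
next
  case (Deref sp e)
  from Deref.prems obtain i where i: "peval L' \<nu> e = Some i" "i < len L' sp" "as_ptr (\<nu> (sp, i)) = Some a"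
    by (auto simp: bind_eq_Some_conv split: if_splits)
  have "peval L \<mu> (be sp) = Some (b sp)" using assms(1) base unfolding sim_def by auto
  moreover have "\<mu> (S sp, b sp + i) = \<nu> (sp, i)" using assms(1) i unfolding sim_def by auto
  ultimately show ?case using Deref.IH[OF i(1)] i range by auto
qed (auto simp: bind_eq_Some_conv)

lemma locate_tr:
  assumes "sim \<nu> \<mu>" "locate L' \<nu> a = Some l"
  shows "locate L \<mu> (tr_addr z S be a) = Some (S (fst l), b (fst l) + snd l) \<and> snd l < len L' (fst l)"
proof (cases a)
  case (Addr sp e)
  with assms(2) obtain i where i: "peval L' \<nu> e = Some i" "i < len L' sp" "l = (sp, i)"
    by (auto simp: bind_eq_Some_conv split: if_splits)
  have "peval L \<mu> (be sp) = Some (b sp)" using assms(1) base unfolding sim_def by auto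
  with peval_tr[OF assms(1) i(1)] i range Addr show ?thesis by auto
qed

lemma fetch_tr:
  assumes "sim \<nu> \<mu>" "fetch L' \<nu> a = Some v"
  shows "fetch L \<mu> (tr_addr z S be a) = Some v"
proof -
  obtain l where l: "locate L' \<nu> a = Some l" "\<nu> l = v" using assms(2) unfolding fetch_def by auto
  with locate_tr[OF assms(1) l(1)] assms(1) show ?thesis unfolding fetch_def sim_def by auto
qed

lemma store_tr:
  assumes "sim \<nu> \<mu>" "store L' \<nu> a v = Some \<nu>'"
  shows "\<exists>\<mu>'. store L \<mu> (tr_addr z S be a) v = Some \<mu>' \<and> sim \<nu>' \<mu>'"
proof -
  obtain sp i where l: "locate L' \<nu> a = Some (sp, i)" "sp \<in> writable L'" "\<nu>' = \<nu>((sp, i) := v)"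
    using assms(2) unfolding store_def by (auto simp: bind_eq_Some_conv split: if_splits)
  note loc = locate_tr[OF assms(1) l(1), simplified]
  have i: "i < len L' sp" using loc by simp
  have "(S sp, b sp + i) \<in> target L' S b" using l(2) i unfolding target_def by blast
  then have "(\<mu>((S sp, b sp + i) := v)) l = \<mu>0 l" if "l \<notin> target L' S b" for l
    using assms(1) that unfolding sim_def by (metis fun_upd_other)
  moreover have "(\<mu>((S sp, b sp + i) := v)) (S sp', b sp' + i') = \<nu>' (sp', i')"
    if i': "i' < len L' sp'" for sp' i'
  proof (cases "(sp', i') = (sp, i)")
    case True
    then show ?thesis using l(3) by simp
  next
    case False
    then have "(S sp', b sp' + i') \<noteq> (S sp, b sp + i)" using inj[OF l(2) i i'] by auto
    with False l(3) assms(1) i' show ?thesis unfolding sim_def by (metis fun_upd_other)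
  qed
  ultimately have "sim \<nu>' (\<mu>((S sp, b sp + i) := v))"
    unfolding sim_def by blast
  with loc wr[OF l(2)] show ?thesis unfolding store_def by simp
qed

lemma step_tr:
  assumes "sim \<nu> \<mu>" "step L' i \<nu> = Some \<nu>'"
  shows "\<exists>\<mu>'. step L (tr_instr z S be i) \<mu> = Some \<mu>' \<and> sim \<nu>' \<mu>'"
proof (cases i)
  case (Load d x)
  then show ?thesis using store_tr assms by auto
next
  case (Point d e)
  with assms obtain p where p: "peval L' \<nu> e = Some p" "p \<le> ptr_bound L'" "store L' \<nu> d (Ptr p) = Some \<nu>'"
    by (auto simp: bind_eq_Some_conv split: if_splits)
  with Point store_tr[OF assms(1) p(3)] peval_tr[OF assms(1) p(1)] bound show ?thesis by auto
next
  case (Move d a)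
  with assms obtain v where "fetch L' \<nu> a = Some v" "store L' \<nu> d v = Some \<nu>'"
    by (auto simp: bind_eq_Some_conv)
  then show ?thesis using Move store_tr[OF assms(1)] fetch_tr[OF assms(1)] by fastforce
next
  case (Arith d f a a')
  with assms obtain v v' x y r where *: "fetch L' \<nu> a = Some v" "as_coef v = Some x"
    "fetch L' \<nu> a' = Some v'" "as_coef v' = Some y" "kop_apply f x y = Some r"
    "store L' \<nu> d (Coef r) = Some \<nu>'"
    by (auto simp: bind_eq_Some_conv)
  from Arith *(2,4,5) store_tr[OF assms(1) *(6)] fetch_tr[OF assms(1) *(1)]
    fetch_tr[OF assms(1) *(3)]
  show ?thesis by simp
qed

text \<open>Each error-free step of the guest is matched by one step of the host. The running time
  is the same because \<open>tr_instr\<close> preserves \<open>cost\<close>.\<close>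

lemma exec_tr:
  assumes "exec L' P \<nu> t \<nu>'" "sim \<nu> \<mu>"
  shows "\<exists>\<mu>'. exec L (tr_prog z S be P) \<mu> t \<mu>' \<and> sim \<nu>' \<mu>'"
  using assms
proof (induction arbitrary: \<mu> rule: exec.induct)
  case exec_Skip
  then show ?case using exec.exec_Skip by auto
next
  case (exec_Do i \<nu> \<nu>')
  obtain \<mu>' where "step L (tr_instr z S be i) \<mu> = Some \<mu>'" "sim \<nu>' \<mu>'"
    using step_tr[OF exec_Do.prems exec_Do.hyps] by blast
  then show ?case using exec.exec_Do[of L "tr_instr z S be i"] by fastforce
next
  case (exec_Seq P \<nu> s \<nu>' Q t \<nu>'')
  obtain \<mu>' where 1: "exec L (tr_prog z S be P) \<mu> s \<mu>'" "sim \<nu>' \<mu>'"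
    using exec_Seq.IH(1)[OF exec_Seq.prems] by blast
  obtain \<mu>'' where 2: "exec L (tr_prog z S be Q) \<mu>' t \<mu>''" "sim \<nu>'' \<mu>''"
    using exec_Seq.IH(2)[OF 1(2)] by blast
  from exec.exec_Seq[OF 1(1) 2(1)] 2(2) show ?case by auto
next
  case (exec_Cond_True \<nu> e1 a e2 b P t \<nu>' Q)
  obtain \<mu>' where 1: "exec L (tr_prog z S be P) \<mu> t \<mu>'" "sim \<nu>' \<mu>'"
    using exec_Cond_True.IH[OF exec_Cond_True.prems] by blast
  from exec.exec_Cond_True[OF peval_tr[OF exec_Cond_True.prems exec_Cond_True.hyps(1)]
      peval_tr[OF exec_Cond_True.prems exec_Cond_True.hyps(2)] exec_Cond_True.hyps(3) 1(1)] 1(2)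
  show ?case by auto
next
  case (exec_Cond_False \<nu> e1 a e2 b Q t \<nu>' P)
  obtain \<mu>' where 1: "exec L (tr_prog z S be Q) \<mu> t \<mu>'" "sim \<nu>' \<mu>'"
    using exec_Cond_False.IH[OF exec_Cond_False.prems] by blast
  from exec.exec_Cond_False[OF peval_tr[OF exec_Cond_False.prems exec_Cond_False.hyps(1)]
      peval_tr[OF exec_Cond_False.prems exec_Cond_False.hyps(2)] exec_Cond_False.hyps(3) 1(1)] 1(2)
  show ?case by auto
next
  case (exec_Loop_True \<nu> e1 a e2 b P s \<nu>' t \<nu>'')
  obtain \<mu>' where 1: "exec L (tr_prog z S be P) \<mu> s \<mu>'" "sim \<nu>' \<mu>'"
    using exec_Loop_True.IH(1)[OF exec_Loop_True.prems] by blast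
  obtain \<mu>'' where 2: "exec L (tr_prog z S be (Loop e1 e2 P)) \<mu>' t \<mu>''" "sim \<nu>'' \<mu>''"
    using exec_Loop_True.IH(2)[OF 1(2)] by blast
  from exec.exec_Loop_True[OF peval_tr[OF exec_Loop_True.prems exec_Loop_True.hyps(1)]
      peval_tr[OF exec_Loop_True.prems exec_Loop_True.hyps(2)] exec_Loop_True.hyps(3) 1(1)
      2(1)[unfolded tr_prog.simps]] 2(2)
  show ?case by auto
next
  case (exec_Loop_False \<nu> e1 a e2 b P)
  from exec.exec_Loop_False[OF peval_tr[OF exec_Loop_False.prems exec_Loop_False.hyps(1)]
      peval_tr[OF exec_Loop_False.prems exec_Loop_False.hyps(2)] exec_Loop_False.hyps(3)]
    exec_Loop_False.prems
  show ?case by auto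
qed

end

section \<open>Products and quotients in terms of coefficients\<close>

text \<open>Reads a window of \<open>m\<close> registers as a polynomial; the cutoff provides the
  degree bound that the product algorithms require of their inputs.\<close>

definition vpoly :: "nat \<Rightarrow> (nat \<Rightarrow> 'a::comm_ring_1) \<Rightarrow> 'a poly" where
  "vpoly m x = Poly (map x [0..<m])"

lemma coeff_vpoly [simp]: "coeff (vpoly m x) i = (if i < m then x i else 0)"
  by (simp add: vpoly_def nth_default_def)

lemma degree_vpoly_less: "m \<ge> 1 \<Longrightarrow> degree (vpoly m x) < m"
  by (rule le_less_trans[OF degree_le[of "m - 1"]]) auto

lemma coeff_short_product_vpoly:
  "t < m \<Longrightarrow> coeff (short_product m (vpoly m x) (vpoly m y)) t = (\<Sum>s\<le>t. x (t - s) * y s)"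
  unfolding short_product_def
  by (subst mult.commute, simp add: coeff_poly_cutoff coeff_mult, rule sum.cong)
    (auto simp: mult.commute)

lemma coeff_middle_product_vpoly:
  assumes "t < m"
  shows "coeff (middle_product m m (vpoly (2 * m - 1) x) (vpoly m y)) t
    = (\<Sum>s<m. y s * x (m - 1 + t - s))"
proof -
  have "coeff (middle_product m m (vpoly (2 * m - 1) x) (vpoly m y)) t
      = coeff (vpoly m y * vpoly (2 * m - 1) x) (m - 1 + t)"
    using assms by (simp add: middle_product_def coeff_poly_cutoff coeff_poly_shift mult.commute add.commute)
  also have "\<dots> = (\<Sum>s\<le>m - 1 + t. (if s < m then y s else 0) * coeff (vpoly (2 * m - 1) x) (m - 1 + t - s))"
    by (simp add: coeff_mult)
  \<comment> \<open>For \<open>s < m\<close> the index \<open>m - 1 + t - s\<close> lies below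
    \<open>2 * m - 1\<close> because \<open>t < m\<close>, so the cutoff of \<open>x\<close> has no
    effect.\<close>
  also have "\<dots> = (\<Sum>s<m. y s * x (m - 1 + t - s))"
    by (rule sum.mono_neutral_cong_right) (use assms in auto)
  finally show ?thesis .
qed

text \<open>Dividing by \<open>X^a\<close> what remains of \<open>f\<close> after the first \<open>a\<close> coefficients of \<open>q\<close> leaves \<open>g\<close> times the
  rest of \<open>q\<close>.  With \<open>f = 1\<close> and \<open>q = u\<close> this is the Newton step.\<close>

lemma fps_quotient_block:
  fixes g u q f :: "'a::comm_ring_1 fps"
  assumes "g * u = 1" "g * q = f"
  shows "fps_nth q (a + t) = (\<Sum>s\<le>t. (fps_nth f (a + (t - s))
    - (\<Sum>j<a. fps_nth q j * fps_nth g (a + (t - s) - j))) * fps_nth u s)"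
proof -
  have R: "fps_nth f (a + m) - (\<Sum>j<a. fps_nth q j * fps_nth g (a + m - j))
      = fps_nth (fps_shift a q * g) m" for m
  proof -
    have "fps_nth f (a + m) = (\<Sum>j\<in>{..a + m}. fps_nth q j * fps_nth g (a + m - j))"
      using assms(2) by (metis fps_mult_nth mult.commute atLeast0AtMost)
    also have "{..a + m} = {..<a} \<union> {a..a+m}" by auto
    also have "(\<Sum>j\<in>\<dots>. fps_nth q j * fps_nth g (a + m - j)) = (\<Sum>j<a. fps_nth q j * fps_nth g (a + m - j))
       + (\<Sum>j\<in>{a..a+m}. fps_nth q j * fps_nth g (a + m - j))"
      by (rule sum.union_disjoint) auto
    also have "(\<Sum>j\<in>{a..a+m}. fps_nth q j * fps_nth g (a + m - j)) = (\<Sum>j\<in>{0..m}. fps_nth q (a + j) * fps_nth g (m - j))"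
      by (rule sum.reindex_bij_witness[of _ "\<lambda>j. a + j" "\<lambda>j. j - a"])
        (auto simp: add.commute)
    finally show ?thesis by (simp add: fps_mult_nth add.commute)
  qed
  have "fps_shift a q = fps_shift a q * g * u"
    using assms(1) by (simp add: mult.assoc)
  then have "fps_nth q (a + t) = fps_nth (u * (fps_shift a q * g)) t"
    by (metis fps_shift_nth add.commute mult.commute)
  then show ?thesis unfolding R by (simp add: fps_mult_nth mult.commute atLeast0AtMost)
qed

section \<open>Building blocks\<close>

text \<open>
  Use of the work registers: 0 holds the size of the next product, 1 the block size \<open>K\<close>, 2 the current row or
  the start of the current block, 3 the start of the block to be updated, 4 the counter of
  innermost loops, 5 the power of two in the Newton iteration, and 6 an element of the ring.
\<close>

abbreviation reg :: "nat \<Rightarrow> addr" where "reg j \<equiv> Addr Work (Num j)"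
abbreviation wreg :: "nat \<Rightarrow> pexp" where "wreg j \<equiv> Deref Work (Num j)"
abbreviation padd :: "pexp \<Rightarrow> pexp \<Rightarrow> pexp" where "padd \<equiv> PBin PPlus"

text \<open>Seven extra registers whatever \<open>n\<close>: this is the constant space
  bound.\<close>

definition lay :: "nat \<Rightarrow> layout" where
  "lay n = \<lparr>psize = n, len = space_lens n n n 7, writable = {Arg1, Out, Work}\<rparr>"

lemma lay_simps [simp]:
  "psize (lay n) = n" "len (lay n) = space_lens n n n 7" "writable (lay n) = {Arg1, Out, Work}"
  "ptr_bound (lay n) = 3 * n + 7"
  by (simp_all add: lay_def ptr_bound_def)

lemma len_lay: "sp \<noteq> Work \<Longrightarrow> len (lay n) sp = n"
  by (cases sp) auto

lemma step_Point:
  "peval (lay n) \<mu> e = Some p \<Longrightarrow> p \<le> 3 * n + 7 \<Longrightarrow> j < 7 \<Longrightarrow>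
   step (lay n) (Point (reg j) e) \<mu> = Some (\<mu>((Work, j) := Ptr p))"
  by (simp add: store_def)

fun by_space :: "'x \<Rightarrow> 'x \<Rightarrow> 'x \<Rightarrow> 'x \<Rightarrow> space \<Rightarrow> 'x" where
  "by_space a b c d Arg1 = a"
| "by_space a b c d Arg2 = b"
| "by_space a b c d Out = c"
| "by_space a b c d Work = d"

text \<open>Output and work space of the guest both lie in \<open>Out\<close>, the work space from
  \<open>2 * K\<close> on, where \<open>K\<close> is in register 1. Register 0 supplies the size of
  the product.\<close>

definition call :: "space \<Rightarrow> pexp \<Rightarrow> space \<Rightarrow> pexp \<Rightarrow> pexp \<Rightarrow> 'k prog \<Rightarrow> 'k prog" where
  "call spA eA spB eB eO P =
     tr_prog (wreg 0) (by_space spA spB Out Out) (by_space eA eB eO (padd (wreg 1) (wreg 1))) P"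

text \<open>An instance of the embedding. Inputs taken from \<open>Out\<close> must lie below the
  work space and avoid the output window; nothing is promised about \<open>Out\<close> from
  \<open>2 * K\<close> on. The bound \<open>3 * n\<close> keeps the guest's pointers within the
  limit of the host.\<close>

lemma runs_call:
  fixes P :: "'k::comm_ring_1 prog"
  assumes comp: "computes {Out, Work} P m a a' r w A B R T"
    and w0: "\<mu> (Work, 0) = Ptr m" and w1: "\<mu> (Work, 1) = Ptr K"
    and eA: "\<And>\<mu>'. (\<And>i. \<mu>' (Work, i) = \<mu> (Work, i)) \<Longrightarrow> peval (lay n) \<mu>' eA = Some oA"
    and eB: "\<And>\<mu>'. (\<And>i. \<mu>' (Work, i) = \<mu> (Work, i)) \<Longrightarrow> peval (lay n) \<mu>' eB = Some oB"
    and eO: "\<And>\<mu>'. (\<And>i. \<mu>' (Work, i) = \<mu> (Work, i)) \<Longrightarrow> peval (lay n) \<mu>' eO = Some oO"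
    and A: "\<And>i. i < a \<Longrightarrow> \<mu> (spA, oA + i) = Coef (coeff A i)"
    and B: "\<And>i. i < a' \<Longrightarrow> \<mu> (spB, oB + i) = Coef (coeff B i)"
    and spA: "spA \<noteq> Work" "oA + a \<le> n" "spA = Out \<Longrightarrow> oA + a \<le> 2 * K \<and> (oA + a \<le> oO \<or> oO + r \<le> oA)"
    and spB: "spB \<noteq> Work" "oB + a' \<le> n" "spB = Out \<Longrightarrow> oB + a' \<le> 2 * K \<and> (oB + a' \<le> oO \<or> oO + r \<le> oB)"
    and O: "oO + r \<le> 2 * K" and w: "2 * K + w \<le> n" and tot: "a + a' + r + w \<le> 3 * n"
  shows "runs (lay n) (call spA eA spB eB eO P) t \<mu> (\<lambda>t' \<mu>'. real t' \<le> real t + T \<and>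
    (\<forall>i<r. \<mu>' (Out, oO + i) = Coef (coeff R i)) \<and>
    (\<forall>l. fst l \<noteq> Out \<or> snd l < oO \<or> oO + r \<le> snd l \<and> snd l < 2 * K \<longrightarrow> \<mu>' l = \<mu> l))"
proof -
  let ?L' = "\<lparr>psize = m, len = space_lens a a' r w, writable = {Out, Work}\<rparr>"
  let ?S = "by_space spA spB Out Out"
  let ?b = "by_space oA oB oO (2 * K)"
  have targ: "l \<notin> target ?L' ?S ?b"
    if "fst l \<noteq> Out \<or> snd l < oO \<or> oO + r \<le> snd l \<and> snd l < 2 * K" for l
  proof
    assume "l \<in> target ?L' ?S ?b"
    then obtain sp i where "sp = Out \<or> sp = Work" "i < space_lens a a' r w sp" "l = (?S sp, ?b sp + i)"
      unfolding target_def by auto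
    with that O show False by auto
  qed
  interpret embedding "lay n" ?L' "wreg 0" ?S "by_space eA eB eO (padd (wreg 1) (wreg 1))" ?b \<mu>
  proof
    fix \<mu>' assume *: "\<And>l. l \<notin> target ?L' ?S ?b \<Longrightarrow> \<mu>' l = \<mu> l"
    have W: "\<mu>' (Work, i) = \<mu> (Work, i)" for i by (rule *) (rule targ, simp)
    show "peval (lay n) \<mu>' (wreg 0) = Some (psize ?L')" using w0 by (simp add: W)
    fix sp show "peval (lay n) \<mu>' (by_space eA eB eO (padd (wreg 1) (wreg 1)) sp) = Some (?b sp)"
      using eA[OF W] eB[OF W] eO[OF W] w1 by (cases sp) (simp_all add: W)
  next
    fix sp i assume "i < len ?L' sp"
    then show "?b sp + i < len (lay n) (?S sp)"
      using spA spB O w by (cases sp) (auto simp: len_lay simp del: lay_simps(2))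
  next
    fix sp i sp' i' assume "sp \<in> writable ?L'" "i < len ?L' sp" "i' < len ?L' sp'"
      "?S sp = ?S sp'" "?b sp + i = ?b sp' + i'"
    then show "sp = sp' \<and> i = i'"
      using spA spB O by (cases sp; cases sp') auto
  next
    show "ptr_bound ?L' \<le> ptr_bound (lay n)" using tot by (simp add: ptr_bound_def)
  qed auto
  \<comment> \<open>\<open>computes\<close> admits any initial output and work registers, so the
    guest can start from the host's contents pulled back along the embedding.\<close>
  define \<nu> where "\<nu> = (\<lambda>l. \<mu> (?S (fst l), ?b (fst l) + snd l))"
  have "holds_poly \<nu> Arg1 a A" "holds_poly \<nu> Arg2 a' B"
    using A B unfolding holds_poly_def \<nu>_def by auto
  with comp obtain s \<nu>' where s: "exec ?L' P \<nu> s \<nu>'" "holds_poly \<nu>' Out r R" "real s \<le> T"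
    unfolding computes_def by blast
  have "sim \<nu> \<mu>" unfolding sim_def \<nu>_def by simp
  from exec_tr[OF s(1) this] obtain \<mu>' where e: "exec (lay n) (call spA eA spB eB eO P) \<mu> s \<mu>'" "sim \<nu>' \<mu>'"
    unfolding call_def by blast
  have "\<mu>' (Out, oO + i) = Coef (coeff R i)" if "i < r" for i
  proof -
    have "\<mu>' (?S Out, ?b Out + i) = \<nu>' (Out, i)" using e(2) that unfolding sim_def
      by (metis layout.select_convs(2) space_lens.simps(3))
    with s(2) that show ?thesis unfolding holds_poly_def by simp
  qed
  moreover have "\<mu>' l = \<mu> l" if "fst l \<noteq> Out \<or> snd l < oO \<or> oO + r \<le> snd l \<and> snd l < 2 * K" for l
    using targ[OF that] e(2) unfolding sim_def by blast
  ultimately show ?thesis unfolding runs_def using e(1) s(3) by (intro exI[of _ s] exI[of _ \<mu>']) auto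
qed

definition vec :: "pexp \<Rightarrow> 'k instr \<Rightarrow> 'k prog" where
  "vec e i = Seq (Do (Point (reg 4) (Num 0)))
     (Loop (wreg 4) e (Seq (Do i) (Do (Point (reg 4) (padd (wreg 4) (Num 1))))))"

text \<open>When index \<open>s\<close> is reached, only the counter and the entries below
  \<open>s\<close> have changed. The instruction may therefore read the old entry \<open>s\<close>
  that it overwrites, as in-place subtraction does.\<close>

lemma runs_vec:
  fixes i :: "'k::comm_ring_1 instr"
  assumes sp: "sp \<noteq> Work" and m: "m \<le> n"
    and e: "\<And>\<mu>'. (\<And>j. j \<noteq> 4 \<Longrightarrow> \<mu>' (Work, j) = \<mu> (Work, j)) \<Longrightarrow> peval (lay n) \<mu>' e = Some m"
    and step: "\<And>s \<mu>'. s < m \<Longrightarrow> \<mu>' (Work, 4) = Ptr s \<Longrightarrow>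
      (\<And>l. l \<noteq> (Work, 4) \<Longrightarrow> (\<And>j. j < s \<Longrightarrow> l \<noteq> (sp, b + j)) \<Longrightarrow> \<mu>' l = \<mu> l) \<Longrightarrow>
      step (lay n) i \<mu>' = Some (\<mu>'((sp, b + s) := Coef (y s)))"
  shows "runs (lay n) (vec e i) t \<mu> (\<lambda>t' \<mu>'. t' = t + m * cost i \<and>
    (\<forall>s<m. \<mu>' (sp, b + s) = Coef (y s)) \<and>
    (\<forall>l. l \<noteq> (Work, 4) \<longrightarrow> (\<forall>j<m. l \<noteq> (sp, b + j)) \<longrightarrow> \<mu>' l = \<mu> l))"
proof -
  define I where "I v t' \<mu>' \<longleftrightarrow> t' = t + v * cost i \<and> \<mu>' (Work, 4) = Ptr v \<and>
    (\<forall>s<v. \<mu>' (sp, b + s) = Coef (y s)) \<and>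
    (\<forall>l. l \<noteq> (Work, 4) \<longrightarrow> (\<forall>j<v. l \<noteq> (sp, b + j)) \<longrightarrow> \<mu>' l = \<mu> l)" for v t' and \<mu>' :: "'k mem"
  have W: "\<mu>' (Work, j) = \<mu> (Work, j)" if "I v t' \<mu>'" "j \<noteq> 4" for v t' \<mu>' j
    using that sp unfolding I_def by auto
  have e': "peval (lay n) \<mu>' e = Some m" if "I v t' \<mu>'" for v t' \<mu>'
    using W[OF that] by (rule e)
  have "runs (lay n) (vec e i) t \<mu> (I m)"
    unfolding vec_def
  proof (rule runs_Do_Seq[OF step_Point[where p = 0]])
    show "runs (lay n) (Loop (wreg 4) e (Seq (Do i) (Do (Point (reg 4) (padd (wreg 4) (Num 1))))))
        (t + cost (Point (reg 4) (Num 0))) (\<mu>((Work, 4) := Ptr 0)) (I m)"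
    proof (rule runs_Loop[where v = 0])
      show "I 0 (t + cost (Point (reg 4) (Num 0))) (\<mu>((Work, 4) := Ptr 0))" by (simp add: I_def)
    next
      fix v t' and \<mu>' :: "'k mem" assume v: "v < m" and I: "I v t' \<mu>'"
      let ?\<nu> = "\<mu>'((sp, b + v) := Coef (y v))"
      have "step (lay n) i \<mu>' = Some ?\<nu>" using I unfolding I_def by (intro step v) (blast+)
      moreover have "step (lay n) (Point (reg 4) (padd (wreg 4) (Num 1))) ?\<nu>
        = Some (?\<nu>((Work, 4) := Ptr (v + 1)))"
        by (rule step_Point) (use v m I sp in \<open>auto simp: I_def\<close>)
      moreover have "I (Suc v) (t' + cost i) (?\<nu>((Work, 4) := Ptr (v + 1)))"
        using I sp unfolding I_def by (auto simp: less_Suc_eq)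
      ultimately have "runs (lay n) (Seq (Do i) (Do (Point (reg 4) (padd (wreg 4) (Num 1))))) t' \<mu>' (I (Suc v))"
        by (intro runs_Do_Seq runs_Do) auto
      then show "(\<exists>a b. peval (lay n) \<mu>' (wreg 4) = Some a \<and> peval (lay n) \<mu>' e = Some b \<and> a < b) \<and>
        runs (lay n) (Seq (Do i) (Do (Point (reg 4) (padd (wreg 4) (Num 1))))) t' \<mu>' (I (Suc v))"
        using e'[OF I] v I by (auto simp: I_def)
    next
      fix t' and \<mu>' :: "'k mem" assume "I m t' \<mu>'"
      then show "\<exists>a b. peval (lay n) \<mu>' (wreg 4) = Some a \<and> peval (lay n) \<mu>' e = Some b \<and> \<not> a < b"
        using e' by (auto simp: I_def)
    qed simp
  qed auto
  then show ?thesis by (rule runs_mono) (auto simp: I_def)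
qed

text \<open>Solves row \<open>i\<close> of the triangular system \<open>G x = y\<close> in place, for the row index \<open>i\<close> in register 2.\<close>

definition row :: "space \<Rightarrow> 'k prog" where
  "row sp = Seq (Seq (Do (Point (reg 4) (Num 1)))
     (Loop (wreg 4) (padd (wreg 2) (Num 1))
       (Seq (Do (Arith (reg 6) KTimes (Addr Arg2 (wreg 4)) (Addr sp (PBin PMinus (wreg 2) (wreg 4)))))
       (Seq (Do (Arith (Addr sp (wreg 2)) KMinus (Addr sp (wreg 2)) (reg 6)))
            (Do (Point (reg 4) (padd (wreg 4) (Num 1))))))))
     (Do (Arith (Addr sp (wreg 2)) KDiv (Addr sp (wreg 2)) (Addr Arg2 (Num 0))))"

text \<open>Entry \<open>i\<close> starts with the full convolution; the known products are
  subtracted, and division by the unit \<open>g 0\<close> isolates \<open>x i\<close>. Each of the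
  \<open>i\<close> products costs a multiplication and a subtraction, the division one operation
  more.\<close>

lemma runs_row:
  fixes g x :: "nat \<Rightarrow> 'k::comm_ring_1"
  assumes sp: "sp \<in> {Arg1, Out}" and i: "i < n" and unit: "g 0 dvd 1"
    and w2: "\<mu> (Work, 2) = Ptr i"
    and G: "\<And>j. j < n \<Longrightarrow> \<mu> (Arg2, j) = Coef (g j)"
    and x: "\<And>j. j < i \<Longrightarrow> \<mu> (sp, j) = Coef (x j)"
    and y: "\<mu> (sp, i) = Coef (\<Sum>s\<le>i. g s * x (i - s))"
  shows "runs (lay n) (row sp) t \<mu> (\<lambda>t' \<mu>'. t' = t + 2 * i + 1 \<and> \<mu>' (sp, i) = Coef (x i) \<and>
    (\<forall>l. l \<notin> {(Work, 4), (Work, 6), (sp, i)} \<longrightarrow> \<mu>' l = \<mu> l))"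
proof -
  define y where "y v = (\<Sum>s\<le>i. g s * x (i - s)) - (\<Sum>s\<in>{1..v}. g s * x (i - s))" for v
  have y_Suc: "y (Suc v) = y v - g (Suc v) * x (i - Suc v)" for v
    by (simp add: y_def algebra_simps)
  have y_i: "y i = g 0 * x i"
  proof -
    have "{..i} = insert 0 {1..i}" by auto
    then show ?thesis by (simp add: y_def)
  qed
  \<comment> \<open>The counter starts at 1, since the diagonal term \<open>g 0 * x i\<close> must
    remain for the division.\<close>
  define I where "I v t' \<mu>' \<longleftrightarrow> t' = t + 2 * v \<and> \<mu>' (Work, 4) = Ptr (v + 1) \<and>
    \<mu>' (sp, i) = Coef (y v) \<and> (\<forall>l. l \<notin> {(Work, 4), (Work, 6), (sp, i)} \<longrightarrow> \<mu>' l = \<mu> l)"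
    for v t' and \<mu>' :: "'k mem"
  have I: "\<mu>' (Work, 4) = Ptr (v + 1)" "\<mu>' (Work, 2) = Ptr i" "\<mu>' (sp, i) = Coef (y v)"
    "\<And>j. j < n \<Longrightarrow> \<mu>' (Arg2, j) = Coef (g j)" "\<And>j. j < i \<Longrightarrow> \<mu>' (sp, j) = Coef (x j)"
    if "I v t' \<mu>'" for v t' \<mu>'
    using that sp G x w2 unfolding I_def by auto
  let ?body = "Seq (Do (Arith (reg 6) KTimes (Addr Arg2 (wreg 4)) (Addr sp (PBin PMinus (wreg 2) (wreg 4)))))
       (Seq (Do (Arith (Addr sp (wreg 2)) KMinus (Addr sp (wreg 2)) (reg 6)))
            (Do (Point (reg 4) (padd (wreg 4) (Num 1)))))"
  have "runs (lay n) (Seq (Do (Point (reg 4) (Num 1))) (Loop (wreg 4) (padd (wreg 2) (Num 1)) ?body)) t \<mu> (I i)"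
  proof (rule runs_Do_Seq[OF step_Point[where p = 1]])
    show "runs (lay n) (Loop (wreg 4) (padd (wreg 2) (Num 1)) ?body)
        (t + cost (Point (reg 4) (Num 1))) (\<mu>((Work, 4) := Ptr 1)) (I i)"
    proof (rule runs_Loop[where v = 0])
      show "I 0 (t + cost (Point (reg 4) (Num 1))) (\<mu>((Work, 4) := Ptr 1))"
        using sp y by (auto simp: I_def y_def)
    next
      fix v t' and \<mu>' :: "'k mem" assume v: "v < i" and Iv: "I v t' \<mu>'"
      let ?z = "g (Suc v) * x (i - Suc v)"
      have "runs (lay n) ?body t' \<mu>' (I (Suc v))"
      proof (rule runs_Do_Seq[where \<mu>' = "\<mu>'((Work, 6) := Coef ?z)"], goal_cases)
        case 1
        then show ?case using I[OF Iv] v i sp by (auto simp: fetch_def store_def)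
      next
        case 2
        show ?case
        proof (rule runs_Do_Seq[where \<mu>' = "\<mu>'((Work, 6) := Coef ?z, (sp, i) := Coef (y (Suc v)))"], goal_cases)
          case 1
          then show ?case using I[OF Iv] v i sp by (auto simp: fetch_def store_def y_Suc)
        next
          case 2
          show ?case
          proof (rule runs_Do[OF step_Point[where p = "Suc v + 1"]], goal_cases)
            case 4
            then show ?case using Iv sp unfolding I_def by auto
          qed (use I[OF Iv] sp v i in auto)
        qed
      qed
      then show "(\<exists>a b. peval (lay n) \<mu>' (wreg 4) = Some a \<and> peval (lay n) \<mu>' (padd (wreg 2) (Num 1)) = Some b \<and> a < b) \<and>
        runs (lay n) ?body t' \<mu>' (I (Suc v))"
        using I[OF Iv] v by auto
    next
      fix t' and \<mu>' :: "'k mem" assume "I i t' \<mu>'"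
      from I[OF this] show "\<exists>a b. peval (lay n) \<mu>' (wreg 4) = Some a \<and>
        peval (lay n) \<mu>' (padd (wreg 2) (Num 1)) = Some b \<and> \<not> a < b"
        by auto
    qed simp
  qed auto
  then show ?thesis
    unfolding row_def
  proof (rule runs_Seq)
    fix t' and \<mu>' :: "'k mem" assume Ii: "I i t' \<mu>'"
    show "runs (lay n) (Do (Arith (Addr sp (wreg 2)) KDiv (Addr sp (wreg 2)) (Addr Arg2 (Num 0)))) t' \<mu>'
      (\<lambda>t' \<mu>'. t' = t + 2 * i + 1 \<and> \<mu>' (sp, i) = Coef (x i) \<and>
        (\<forall>l. l \<notin> {(Work, 4), (Work, 6), (sp, i)} \<longrightarrow> \<mu>' l = \<mu> l))"
    proof (rule runs_Do[where \<mu>' = "\<mu>'((sp, i) := Coef (x i))"])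
      show "step (lay n) (Arith (Addr sp (wreg 2)) KDiv (Addr sp (wreg 2)) (Addr Arg2 (Num 0))) \<mu>'
          = Some (\<mu>'((sp, i) := Coef (x i)))"
        using I[OF Ii] i sp unit
        by (auto simp: fetch_def store_def y_i unit_quotient_eq)
    qed (use Ii in \<open>auto simp: I_def\<close>)
  qed
qed

section \<open>Division by blocks\<close>

text \<open>These rows are untouched by the block updates, so they start from \<open>f\<close>. With
  0 in register 1 the whole system is solved.\<close>

definition naive_prog :: "nat \<Rightarrow> 'k prog" where
  "naive_prog h = Seq (Do (Point (reg 2) (PBin PTimes (Num h) (wreg 1))))
     (Loop (wreg 2) Size (Seq (row Arg1) (Do (Point (reg 2) (padd (wreg 2) (Num 1))))))"

text \<open>One Newton step from precision \<open>l\<close>, held in register 0. The middle product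
  gives the coefficients \<open>l\<close> to \<open>2 * l - 1\<close> of \<open>G * U\<close>; their
  short product with \<open>U\<close>, negated as \<open>0 - x\<close>, extends \<open>U\<close>. If
  the next precision is odd, \<open>Cond\<close> adds one coefficient by a row of
  \<open>G * U = 1\<close>.\<close>

definition newton_body :: "'k::comm_ring_1 prog \<Rightarrow> 'k prog \<Rightarrow> 'k prog" where
  "newton_body MP SP =
     Seq (Do (Point (reg 5) (PBin PDiv (wreg 5) (Num 2))))
    (Seq (call Arg2 (Num 1) Out (Num 0) (wreg 1) MP)
    (Seq (call Out (wreg 1) Out (Num 0) (wreg 0) SP)
    (Seq (Do (Load (reg 6) 0))
    (Seq (vec (wreg 0) (Arith (Addr Out (padd (wreg 0) (wreg 4))) KMinus (reg 6) (Addr Out (padd (wreg 0) (wreg 4)))))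
    (Seq (Do (Point (reg 2) (PBin PTimes (wreg 0) (Num 2))))
    (Seq (Cond (wreg 2) (PBin PDiv (wreg 1) (wreg 5)) (Seq (Do (Load (Addr Out (wreg 2)) 0)) (row Out)) Skip)
         (Do (Point (reg 0) (PBin PDiv (wreg 1) (wreg 5))))))))))"

definition newton_prog :: "'k::comm_ring_1 prog \<Rightarrow> 'k prog \<Rightarrow> 'k prog" where
  "newton_prog MP SP =
     Seq (Do (Point (reg 5) (Num 1)))
    (Seq (Loop (PBin PTimes (wreg 5) (Num 2)) (padd (wreg 1) (Num 1))
       (Do (Point (reg 5) (PBin PTimes (wreg 5) (Num 2)))))
    (Seq (Do (Load (Addr Out (Num 0)) 1))
    (Seq (Do (Point (reg 2) (Num 0)))
    (Seq (row Out)
    (Seq (Do (Point (reg 0) (Num 1)))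
         (Loop (Num 1) (wreg 5) (newton_body MP SP)))))))"

definition update :: "'k prog \<Rightarrow> 'k prog" where
  "update MP =
     Seq (call Arg2 (padd (PBin PMinus (PBin PMinus (wreg 3) (wreg 2)) (wreg 1)) (Num 1)) Arg1 (wreg 2) (wreg 1) MP)
    (Seq (vec (wreg 1) (Arith (Addr Arg1 (padd (wreg 3) (wreg 4))) KMinus
           (Addr Arg1 (padd (wreg 3) (wreg 4))) (Addr Out (padd (wreg 1) (wreg 4)))))
         (Do (Point (reg 3) (padd (wreg 3) (wreg 1)))))"

definition solve_block :: "'k prog \<Rightarrow> 'k prog" where
  "solve_block SP =
     Seq (call Arg1 (wreg 2) Out (Num 0) (wreg 1) SP)
         (vec (wreg 1) (Move (Addr Arg1 (padd (wreg 2) (wreg 4))) (Addr Out (padd (wreg 1) (wreg 4)))))"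

definition blocks_prog :: "nat \<Rightarrow> 'k prog \<Rightarrow> 'k prog \<Rightarrow> 'k prog" where
  "blocks_prog h MP SP =
     Seq (Do (Point (reg 2) (Num 0)))
         (Loop (wreg 2) (PBin PTimes (Num h) (wreg 1))
       (Seq (solve_block SP)
       (Seq (Do (Point (reg 3) (padd (wreg 2) (wreg 1))))
       (Seq (Loop (wreg 3) (PBin PTimes (Num h) (wreg 1)) (update MP))
            (Do (Point (reg 2) (padd (wreg 2) (wreg 1))))))))"

locale division =
  fixes n :: nat and g f q :: "nat \<Rightarrow> 'k::comm_ring_1"
  assumes n: "n \<ge> 1" and unit: "g 0 dvd 1" and gq: "Abs_fps g * Abs_fps q = Abs_fps f"
begin

lemma row_sum: "(\<Sum>s\<le>i. g s * q (i - s)) = f i"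
  using arg_cong[OF gq, of "\<lambda>p. fps_nth p i"] by (simp add: fps_mult_nth atLeast0AtMost)

text \<open>Row \<open>v < n\<close> costs \<open>2 * v + 1 <= 2 * n\<close> operations; the total
  is linear in \<open>n\<close> as long as the number of rows treated here is bounded.\<close>

lemma runs_naive:
  assumes w1: "\<mu> (Work, 1) = Ptr K" and hK: "h * K \<le> n"
    and G: "\<And>j. j < n \<Longrightarrow> \<mu> (Arg2, j) = Coef (g j)"
    and F: "\<And>j. j < n \<Longrightarrow> \<mu> (Arg1, j) = Coef (if j < h * K then q j else f j)"
  shows "runs (lay n) (naive_prog h) t \<mu> (\<lambda>t' \<mu>'. t' \<le> t + (n - h * K) * (2 * n) \<and>
    (\<forall>j<n. \<mu>' (Arg1, j) = Coef (q j)))"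
proof -
  define I where "I v t' \<mu>' \<longleftrightarrow> t' \<le> t + (v - h * K) * (2 * n) \<and> \<mu>' (Work, 2) = Ptr v \<and> h * K \<le> v \<and>
    (\<forall>j<n. \<mu>' (Arg2, j) = Coef (g j)) \<and>
    (\<forall>j<n. \<mu>' (Arg1, j) = Coef (if j < v then q j else f j))" for v t' and \<mu>' :: "'k mem"
  have "runs (lay n) (naive_prog h) t \<mu> (I n)"
    unfolding naive_prog_def
  proof (rule runs_Do_Seq[OF step_Point[where p = "h * K"]], goal_cases)
    case 4
    show ?case
    proof (rule runs_Loop[where v = "h * K"], goal_cases)
      case 1
      then show ?case using G F by (auto simp: I_def)
    next
      case (3 v t' \<mu>')
      have "runs (lay n) (row Arg1) t' \<mu>' (\<lambda>t'' \<mu>''. t'' = t' + 2 * v + 1 \<and> \<mu>'' (Arg1, v) = Coef (q v) \<and>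
        (\<forall>l. l \<notin> {(Work, 4), (Work, 6), (Arg1, v)} \<longrightarrow> \<mu>'' l = \<mu>' l))"
        by (rule runs_row[where g = g]) (use 3 unit in \<open>auto simp: I_def row_sum\<close>)
      then have "runs (lay n) (Seq (row Arg1) (Do (Point (reg 2) (padd (wreg 2) (Num 1))))) t' \<mu>' (I (Suc v))"
      proof (rule runs_Seq, goal_cases)
        case (1 t'' \<mu>'')
        from 3 have le: "t' \<le> t + (v - h * K) * (2 * n)" "h * K \<le> v" "v < n" by (auto simp: I_def)
        have "t'' \<le> t + (v - h * K) * (2 * n) + 2 * n" using 1 le by linarith
        also have "\<dots> = t + (Suc v - h * K) * (2 * n)" using le by (simp add: Suc_diff_le)
        finally have "t'' \<le> t + (Suc v - h * K) * (2 * n)" .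
        with 1 3 show ?case
          by (intro runs_Do[OF step_Point[where p = "Suc v"]]) (auto simp: I_def less_Suc_eq)
      qed
      moreover have "\<exists>a b. peval (lay n) \<mu>' (wreg 2) = Some a \<and> peval (lay n) \<mu>' Size = Some b \<and> a < b"
        using 3 by (auto simp: I_def)
      ultimately show ?case by blast
    qed (use hK in \<open>auto simp: I_def\<close>)
  qed (use w1 hK in auto)
  then show ?thesis by (rule runs_mono) (auto simp: I_def)
qed

end

text \<open>The bounds on \<open>Tm m\<close> and \<open>Ts m\<close> say that the cost per
  coefficient at size \<open>m\<close> is at most that at size \<open>K\<close>; this makes the
  Newton costs sum geometrically. Time and space are assumed for all \<open>m <= K\<close> because
  the Newton steps call the products at smaller sizes.\<close>

locale block_division = division n g f q
  for n :: nat and g f q :: "nat \<Rightarrow> 'k::comm_ring_1" +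
  fixes u :: "nat \<Rightarrow> 'k" and h K :: nat and MP SP :: "'k prog" and wm ws :: "nat \<Rightarrow> nat"
    and Tm Ts :: "nat \<Rightarrow> real"
  assumes gu: "Abs_fps g * Abs_fps u = 1" and K: "1 \<le> K" and hK: "h * K \<le> n" and h: "4 \<le> h"
    and MP: "\<And>m A B. 1 \<le> m \<Longrightarrow> m \<le> K \<Longrightarrow> degree A < 2 * m - 1 \<Longrightarrow> degree B < m \<Longrightarrow>
      computes {Out, Work} MP m (2 * m - 1) m m (wm m) A B (middle_product m m A B) (Tm m)"
    and SP: "\<And>m A B. 1 \<le> m \<Longrightarrow> m \<le> K \<Longrightarrow> degree A < m \<Longrightarrow> degree B < m \<Longrightarrow>
      computes {Out, Work} SP m m m m (ws m) A B (short_product m A B) (Ts m)"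
    and wm: "\<And>m. 1 \<le> m \<Longrightarrow> m \<le> K \<Longrightarrow> 2 * K + wm m \<le> n"
    and ws: "\<And>m. 1 \<le> m \<Longrightarrow> m \<le> K \<Longrightarrow> 2 * K + ws m \<le> n"
    and Tm: "\<And>m. 1 \<le> m \<Longrightarrow> m \<le> K \<Longrightarrow> Tm m \<le> real m * (Tm K / real K)"
    and Ts: "\<And>m. 1 \<le> m \<Longrightarrow> m \<le> K \<Longrightarrow> Ts m \<le> real m * (Ts K / real K)"
    and T0: "0 \<le> Tm K" "0 \<le> Ts K"
begin

lemma K4: "4 * K \<le> n"
  using h hK mult_le_mono1[OF h, of K] by linarith

lemma u_sum: "(\<Sum>s\<le>i. g s * u (i - s)) = (if i = 0 then 1 else 0)"
  using arg_cong[OF gu, of "\<lambda>p. fps_nth p i"] by (simp add: fps_mult_nth atLeast0AtMost)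

lemma q_block:
  "q (a + t) = (\<Sum>s\<le>t. (f (a + (t - s)) - (\<Sum>j<a. q j * g (a + (t - s) - j))) * u s)"
  using fps_quotient_block[OF gu gq, of a t] by simp

lemma u_block:
  assumes "1 \<le> l"
  shows "u (l + t) = - (\<Sum>s\<le>t. (\<Sum>j<l. u j * g (l + (t - s) - j)) * u s)"
  using fps_quotient_block[OF gu gu, of l t] assms by (simp add: sum_negf)

section \<open>The product algorithms run inside the output space\<close>

text \<open>The result goes to the second block of \<open>Out\<close>. The window of the divisor has
  \<open>2 * m - 1\<close> registers, hence the bound \<open>n + 1\<close>.\<close>

lemma runs_MP:
  assumes m: "1 \<le> m" "m \<le> K" and w: "\<mu> (Work, 0) = Ptr m" "\<mu> (Work, 1) = Ptr K"
    and eA: "\<And>\<mu>'. (\<And>i. \<mu>' (Work, i) = \<mu> (Work, i)) \<Longrightarrow> peval (lay n) \<mu>' eA = Some oA"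
    and eB: "\<And>\<mu>'. (\<And>i. \<mu>' (Work, i) = \<mu> (Work, i)) \<Longrightarrow> peval (lay n) \<mu>' eB = Some oB"
    and G: "\<And>j. j < n \<Longrightarrow> \<mu> (Arg2, j) = Coef (g j)" and oA: "oA + 2 * m \<le> n + 1"
    and B: "\<And>i. i < m \<Longrightarrow> \<mu> (spB, oB + i) = Coef (y i)"
    and spB: "spB \<noteq> Work" "oB + m \<le> n" "spB = Out \<Longrightarrow> oB + m \<le> K"
  shows "runs (lay n) (call Arg2 eA spB eB (wreg 1) MP) t \<mu> (\<lambda>t' \<mu>'. real t' \<le> real t + Tm m \<and>
    (\<forall>i<m. \<mu>' (Out, K + i) = Coef (\<Sum>s<m. y s * g (oA + (m - 1 + i - s)))) \<and>
    (\<forall>l. fst l \<noteq> Out \<or> snd l < K \<longrightarrow> \<mu>' l = \<mu> l))"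
proof -
  let ?A = "vpoly (2 * m - 1) (\<lambda>i. g (oA + i))"
  let ?B = "vpoly m y"
  have "computes {Out, Work} MP m (2 * m - 1) m m (wm m) ?A ?B (middle_product m m ?A ?B) (Tm m)"
    using m by (intro MP degree_vpoly_less) auto
  then have "runs (lay n) (call Arg2 eA spB eB (wreg 1) MP) t \<mu> (\<lambda>t' \<mu>'. real t' \<le> real t + Tm m \<and>
    (\<forall>i<m. \<mu>' (Out, K + i) = Coef (coeff (middle_product m m ?A ?B) i)) \<and>
    (\<forall>l. fst l \<noteq> Out \<or> snd l < K \<or> K + m \<le> snd l \<and> snd l < 2 * K \<longrightarrow> \<mu>' l = \<mu> l))"
    by (rule runs_call[where K = K and oA = oA and oB = oB])
      (use m w eA eB G oA B spB wm[OF m] K4 in auto)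
  then show ?thesis
    by (rule runs_mono) (simp add: coeff_middle_product_vpoly del: One_nat_def)
qed

text \<open>The second factor is always the inverse at the start of \<open>Out\<close>. The output
  starts at \<open>K\<close> for a block of the quotient, and at the current precision in a Newton
  step, directly behind the known coefficients.\<close>

lemma runs_SP:
  assumes m: "1 \<le> m" "m \<le> K" and w: "\<mu> (Work, 0) = Ptr m" "\<mu> (Work, 1) = Ptr K"
    and eA: "\<And>\<mu>'. (\<And>i. \<mu>' (Work, i) = \<mu> (Work, i)) \<Longrightarrow> peval (lay n) \<mu>' eA = Some oA"
    and eO: "\<And>\<mu>'. (\<And>i. \<mu>' (Work, i) = \<mu> (Work, i)) \<Longrightarrow> peval (lay n) \<mu>' eO = Some oO"
    and A: "\<And>i. i < m \<Longrightarrow> \<mu> (spA, oA + i) = Coef (x i)"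
    and U: "\<And>i. i < m \<Longrightarrow> \<mu> (Out, i) = Coef (u i)"
    and oO: "m \<le> oO" "oO + m \<le> 2 * K"
    and spA: "spA \<noteq> Work" "oA + m \<le> n" "spA = Out \<Longrightarrow> oA + m \<le> 2 * K \<and> oO + m \<le> oA"
  shows "runs (lay n) (call spA eA Out (Num 0) eO SP) t \<mu> (\<lambda>t' \<mu>'. real t' \<le> real t + Ts m \<and>
    (\<forall>i<m. \<mu>' (Out, oO + i) = Coef (\<Sum>s\<le>i. x (i - s) * u s)) \<and>
    (\<forall>l. fst l \<noteq> Out \<or> snd l < oO \<longrightarrow> \<mu>' l = \<mu> l))"
proof -
  let ?A = "vpoly m x" and ?B = "vpoly m u"
  have "computes {Out, Work} SP m m m m (ws m) ?A ?B (short_product m ?A ?B) (Ts m)"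
    using m by (intro SP degree_vpoly_less) auto
  then have "runs (lay n) (call spA eA Out (Num 0) eO SP) t \<mu> (\<lambda>t' \<mu>'. real t' \<le> real t + Ts m \<and>
    (\<forall>i<m. \<mu>' (Out, oO + i) = Coef (coeff (short_product m ?A ?B) i)) \<and>
    (\<forall>l. fst l \<noteq> Out \<or> snd l < oO \<or> oO + m \<le> snd l \<and> snd l < 2 * K \<longrightarrow> \<mu>' l = \<mu> l))"
    by (rule runs_call[where K = K and oA = oA and oB = 0])
      (use m w eA eO A U oO spA ws[OF m] K4 in auto)
  then show ?thesis
    by (rule runs_mono) (auto simp: coeff_short_product_vpoly)
qed

section \<open>Newton iteration for the inverse of the divisor\<close>

definition newton_state :: "nat \<Rightarrow> 'k mem \<Rightarrow> bool" where
  "newton_state l \<mu> \<longleftrightarrow> \<mu> (Work, 1) = Ptr K \<and> (\<forall>j<n. \<mu> (Arg2, j) = Coef (g j)) \<and>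
     (\<forall>j<n. \<mu> (Arg1, j) = Coef (f j)) \<and> (\<forall>j<l. \<mu> (Out, j) = Coef (u j))"

text \<open>For \<open>l = K div (2 * d)\<close>, the next precision \<open>K div d\<close> is
  \<open>2 * l\<close> or \<open>2 * l + 1\<close>, so doubling and at most one naive coefficient
  reach it. The linear term covers \<open>l\<close> negations and a row of cost
  \<open>4 * l + 1 <= 5 * l\<close>.\<close>

lemma runs_newton_body:
  assumes d: "1 \<le> d" "2 * d \<le> K"
    and S: "newton_state (K div (2 * d)) \<mu>" "\<mu> (Work, 0) = Ptr (K div (2 * d))" "\<mu> (Work, 5) = Ptr (2 * d)"
  shows "runs (lay n) (newton_body MP SP) t \<mu> (\<lambda>t' \<mu>'. newton_state (K div d) \<mu>' \<and>
    \<mu>' (Work, 0) = Ptr (K div d) \<and> \<mu>' (Work, 5) = Ptr d \<and>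
    real t' \<le> real t + Tm (K div (2 * d)) + Ts (K div (2 * d)) + 6 * real (K div (2 * d)))"
proof -
  define l where "l = K div (2 * d)"
  have l1: "1 \<le> l" using d by (simp add: l_def div_greater_zero_iff Suc_le_eq)
  have l2: "2 * l \<le> K div d" "K div d \<le> 2 * l + 1"
  proof -
    have "l = K div d div 2" unfolding l_def by (simp add: div_mult2_eq mult.commute)
    then show "2 * l \<le> K div d" "K div d \<le> 2 * l + 1" by linarith+
  qed
  have "K div d \<le> K" by simp
  with l2 have lK: "2 * l \<le> K" by linarith
  \<comment> \<open>Coefficient \<open>l + t\<close> of \<open>G\<close> times the known part of
    \<open>U\<close>. It involves \<open>g\<close> only from index 1 on, which is where the window
    starts.\<close>
  define E where "E t = (\<Sum>s<l. u s * g (l + t - s))" for t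
  define w where "w a b c \<mu> \<longleftrightarrow> newton_state c \<mu> \<and> \<mu> (Work, 0) = Ptr a \<and> \<mu> (Work, 5) = Ptr b"
    for a b c and \<mu> :: "'k mem"
  note defs = w_def newton_state_def
  have S': "w l (2 * d) l \<mu>" using S by (simp add: w_def l_def)
  let ?C = "real t + Tm l + Ts l"
  have p0: "runs (lay n) (Do (Point (reg 5) (PBin PDiv (wreg 5) (Num 2)))) t \<mu> (\<lambda>t' \<mu>'. t' = t \<and> w l d l \<mu>')"
    by (rule runs_Do[OF step_Point[where p = d]]) (use S' d K4 in \<open>auto simp: defs\<close>)
  have p1: "runs (lay n) (call Arg2 (Num 1) Out (Num 0) (wreg 1) MP) t' \<mu>'
      (\<lambda>t' \<mu>'. w l d l \<mu>' \<and> (\<forall>i<l. \<mu>' (Out, K + i) = Coef (E i)) \<and> real t' \<le> real t + Tm l)"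
    if "t' = t \<and> w l d l \<mu>'" for t' \<mu>'
  proof -
    have E: "(\<Sum>s<l. u s * g (1 + (l - 1 + i - s))) = E i" for i
      unfolding E_def
    proof (rule sum.cong)
      fix s assume "s \<in> {..<l}"
      then have eq: "1 + (l - 1 + i - s) = l + i - s" by auto
      show "u s * g (1 + (l - 1 + i - s)) = u s * g (l + i - s)" unfolding eq ..
    qed simp
    have "runs (lay n) (call Arg2 (Num 1) Out (Num 0) (wreg 1) MP) t' \<mu>' (\<lambda>t'' \<mu>''. real t'' \<le> real t' + Tm l \<and>
      (\<forall>i<l. \<mu>'' (Out, K + i) = Coef (\<Sum>s<l. u s * g (1 + (l - 1 + i - s)))) \<and>
      (\<forall>l. fst l \<noteq> Out \<or> snd l < K \<longrightarrow> \<mu>'' l = \<mu>' l))"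
      by (rule runs_MP[where oB = 0]) (use that lK l1 K4 in \<open>auto simp: defs\<close>)
    then show ?thesis unfolding E by (rule runs_mono) (use that lK in \<open>auto simp: defs\<close>)
  qed
  have p2: "runs (lay n) (call Out (wreg 1) Out (Num 0) (wreg 0) SP) t' \<mu>'
      (\<lambda>t' \<mu>'. w l d l \<mu>' \<and> (\<forall>i<l. \<mu>' (Out, l + i) = Coef (- u (l + i))) \<and> real t' \<le> ?C)"
    if a: "w l d l \<mu>' \<and> (\<forall>i<l. \<mu>' (Out, K + i) = Coef (E i)) \<and> real t' \<le> real t + Tm l" for t' \<mu>'
  proof -
    have E: "(\<Sum>s\<le>i. E (i - s) * u s) = - u (l + i)" for i
      unfolding u_block[OF l1] E_def by simp
    have "runs (lay n) (call Out (wreg 1) Out (Num 0) (wreg 0) SP) t' \<mu>' (\<lambda>t'' \<mu>''. real t'' \<le> real t' + Ts l \<and>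
      (\<forall>i<l. \<mu>'' (Out, l + i) = Coef (\<Sum>s\<le>i. E (i - s) * u s)) \<and>
      (\<forall>l'. fst l' \<noteq> Out \<or> snd l' < l \<longrightarrow> \<mu>'' l' = \<mu>' l'))"
      by (rule runs_SP[where oA = K]) (use a lK l1 K4 in \<open>auto simp: defs\<close>)
    then show ?thesis unfolding E by (rule runs_mono) (use a lK in \<open>auto simp: defs\<close>)
  qed
  have p3: "runs (lay n) (Do (Load (reg 6) 0)) t' \<mu>'
      (\<lambda>t' \<mu>'. w l d l \<mu>' \<and> (\<forall>i<l. \<mu>' (Out, l + i) = Coef (- u (l + i))) \<and> \<mu>' (Work, 6) = Coef 0 \<and> real t' \<le> ?C)"
    if a: "w l d l \<mu>' \<and> (\<forall>i<l. \<mu>' (Out, l + i) = Coef (- u (l + i))) \<and> real t' \<le> ?C" for t' \<mu>'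
    by (rule runs_Do[where \<mu>' = "\<mu>'((Work, 6) := Coef 0)"]) (use a in \<open>auto simp: defs store_def\<close>)
  have p4: "runs (lay n) (vec (wreg 0) (Arith (Addr Out (padd (wreg 0) (wreg 4))) KMinus (reg 6) (Addr Out (padd (wreg 0) (wreg 4))))) t' \<mu>'
      (\<lambda>t' \<mu>'. w l d (2 * l) \<mu>' \<and> real t' \<le> ?C + l)"
    if a: "w l d l \<mu>' \<and> (\<forall>i<l. \<mu>' (Out, l + i) = Coef (- u (l + i))) \<and> \<mu>' (Work, 6) = Coef 0 \<and> real t' \<le> ?C" for t' \<mu>'
  proof -
    let ?i = "Arith (Addr Out (padd (wreg 0) (wreg 4))) KMinus (reg 6) (Addr Out (padd (wreg 0) (wreg 4))) :: 'k instr"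
    have "runs (lay n) (vec (wreg 0) ?i) t' \<mu>' (\<lambda>t'' \<mu>''. t'' = t' + l * cost ?i \<and>
      (\<forall>s<l. \<mu>'' (Out, l + s) = Coef (u (l + s))) \<and>
      (\<forall>l'. l' \<noteq> (Work, 4) \<longrightarrow> (\<forall>j<l. l' \<noteq> (Out, l + j)) \<longrightarrow> \<mu>'' l' = \<mu>' l'))"
      by (rule runs_vec) (use a lK K4 in \<open>auto simp: defs fetch_def store_def\<close>)
    then show ?thesis
    proof (rule runs_mono)
      fix t'' \<mu>''
      assume b: "t'' = t' + l * cost ?i \<and> (\<forall>s<l. \<mu>'' (Out, l + s) = Coef (u (l + s))) \<and>
        (\<forall>l'. l' \<noteq> (Work, 4) \<longrightarrow> (\<forall>j<l. l' \<noteq> (Out, l + j)) \<longrightarrow> \<mu>'' l' = \<mu>' l')"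
      have "\<mu>'' (Out, j) = Coef (u j)" if "j < 2 * l" for j
      proof (cases "j < l")
        case True
        then have "\<mu>'' (Out, j) = \<mu>' (Out, j)" using b by auto
        then show ?thesis using a True by (auto simp: defs)
      next
        case False
        then have "j - l < l" using that by simp
        with b have "\<mu>'' (Out, l + (j - l)) = Coef (u (l + (j - l)))" by blast
        then show ?thesis using False by simp
      qed
      then show "w l d (2 * l) \<mu>'' \<and> real t'' \<le> ?C + l"
        using a b by (auto simp: defs)
    qed
  qed
  have p5: "runs (lay n) (Do (Point (reg 2) (PBin PTimes (wreg 0) (Num 2)))) t' \<mu>'
      (\<lambda>t' \<mu>'. w l d (2 * l) \<mu>' \<and> \<mu>' (Work, 2) = Ptr (2 * l) \<and> real t' \<le> ?C + l)"
    if a: "w l d (2 * l) \<mu>' \<and> real t' \<le> ?C + l" for t' \<mu>'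
    by (rule runs_Do[OF step_Point[where p = "2 * l"]]) (use a lK K4 in \<open>auto simp: defs\<close>)
  have p6: "runs (lay n) (Cond (wreg 2) (PBin PDiv (wreg 1) (wreg 5)) (Seq (Do (Load (Addr Out (wreg 2)) 0)) (row Out)) Skip) t' \<mu>'
      (\<lambda>t' \<mu>'. w l d (K div d) \<mu>' \<and> real t' \<le> ?C + 6 * l)"
    if a: "w l d (2 * l) \<mu>' \<and> \<mu>' (Work, 2) = Ptr (2 * l) \<and> real t' \<le> ?C + l" for t' \<mu>'
  proof (rule runs_Cond[where a = "2 * l" and b = "K div d"])
    assume "2 * l < K div d"
    then have ld: "K div d = 2 * l + 1" using l2 by simp
    have ln: "2 * l < n" using lK K4 K by linarith
    \<comment> \<open>Row \<open>2 * l\<close> of \<open>G * U = 1\<close> has right-hand side 0,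
      since \<open>2 * l > 0\<close>.\<close>
    let ?\<mu> = "\<mu>'((Out, 2 * l) := Coef 0)"
    show "runs (lay n) (Seq (Do (Load (Addr Out (wreg 2)) 0)) (row Out)) t' \<mu>'
      (\<lambda>t' \<mu>'. w l d (K div d) \<mu>' \<and> real t' \<le> ?C + 6 * l)"
    proof (rule runs_Do_Seq)
      show "step (lay n) (Load (Addr Out (wreg 2)) 0) \<mu>' = Some ?\<mu>" using a ln by (simp add: store_def)
      have "runs (lay n) (row Out) t' ?\<mu> (\<lambda>t'' \<mu>''. t'' = t' + 2 * (2 * l) + 1 \<and>
        \<mu>'' (Out, 2 * l) = Coef (u (2 * l)) \<and>
        (\<forall>l'. l' \<notin> {(Work, 4), (Work, 6), (Out, 2 * l)} \<longrightarrow> \<mu>'' l' = ?\<mu> l'))"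
        by (rule runs_row[where g = g]) (use a unit l1 ln in \<open>auto simp: u_sum defs\<close>)
      then show "runs (lay n) (row Out) (t' + cost (Load (Addr Out (wreg 2)) 0)) ?\<mu>
        (\<lambda>t' \<mu>'. w l d (K div d) \<mu>' \<and> real t' \<le> ?C + 6 * l)"
        using a l1 by (auto elim!: runs_mono simp: ld defs less_Suc_eq)
    qed
  next
    assume "\<not> 2 * l < K div d"
    then have "K div d = 2 * l" using l2 by simp
    with a show "runs (lay n) Skip t' \<mu>' (\<lambda>t' \<mu>'. w l d (K div d) \<mu>' \<and> real t' \<le> ?C + 6 * l)"
      by (intro runs_Skip) auto
  qed (use a in \<open>auto simp: defs\<close>)
  have p7: "runs (lay n) (Do (Point (reg 0) (PBin PDiv (wreg 1) (wreg 5)))) t' \<mu>'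
      (\<lambda>t' \<mu>'. w (K div d) d (K div d) \<mu>' \<and> real t' \<le> ?C + 6 * l)"
    if a: "w l d (K div d) \<mu>' \<and> real t' \<le> ?C + 6 * l" for t' \<mu>'
    by (rule runs_Do[OF step_Point[where p = "K div d"]])
      (use a le_trans[OF \<open>K div d \<le> K\<close>, of "3 * n + 7"] K4 in \<open>auto simp: defs\<close>)
  have "runs (lay n) (newton_body MP SP) t \<mu> (\<lambda>t' \<mu>'. w (K div d) d (K div d) \<mu>' \<and> real t' \<le> ?C + 6 * l)"
    unfolding newton_body_def
    by (rule runs_Seq[OF p0], rule runs_Seq, erule p1, rule runs_Seq, erule p2, rule runs_Seq,
        erule p3, rule runs_Seq, erule p4, rule runs_Seq, erule p5, rule runs_Seq, erule p6, erule p7)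
  then show ?thesis by (rule runs_mono) (auto simp: w_def l_def)
qed

text \<open>With a budget of \<open>A\<close> per coefficient, the time stays below the precision
  times \<open>A\<close>: a step from precision \<open>l\<close> costs at most \<open>l * A\<close>
  and at least doubles the precision. At precision \<open>K\<close> the budget is one product of
  each kind plus \<open>6 * K\<close>.\<close>

lemma runs_newton:
  assumes S: "newton_state 0 \<mu>"
  shows "runs (lay n) (newton_prog MP SP) t \<mu> (\<lambda>t' \<mu>'. newton_state K \<mu>' \<and> \<mu>' (Work, 0) = Ptr K \<and>
    real t' \<le> real t + Tm K + Ts K + 6 * real K)"
proof -
  \<comment> \<open>\<open>J\<close> is the integer part of the base-2 logarithm of
    \<open>K\<close>, so the precisions \<open>K div 2 ^ j\<close> begin with 1.\<close>
  obtain J where J: "2 ^ J \<le> K" "K < 2 ^ Suc J"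
    using ex_power_ivl1[of 2 K] K by auto
  define A where "A = (Tm K + Ts K) / real K + 6"
  note defs = newton_state_def
  have p0: "runs (lay n) (Do (Point (reg 5) (Num 1))) t \<mu>
      (\<lambda>t' \<mu>'. t' = t \<and> newton_state 0 \<mu>' \<and> \<mu>' (Work, 5) = Ptr (2 ^ 0))"
    by (rule runs_Do[OF step_Point[where p = 1]]) (use S in \<open>auto simp: defs\<close>)
  have p1: "runs (lay n) (Loop (PBin PTimes (wreg 5) (Num 2)) (padd (wreg 1) (Num 1))
       (Do (Point (reg 5) (PBin PTimes (wreg 5) (Num 2))))) t' \<mu>'
      (\<lambda>t' \<mu>'. t' = t \<and> newton_state 0 \<mu>' \<and> \<mu>' (Work, 5) = Ptr (2 ^ J))"
    if "t' = t \<and> newton_state 0 \<mu>' \<and> \<mu>' (Work, 5) = Ptr (2 ^ 0)" for t' \<mu>'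
  proof (rule runs_Loop[where I = "\<lambda>v t' \<mu>'. t' = t \<and> newton_state 0 \<mu>' \<and> \<mu>' (Work, 5) = Ptr (2 ^ v)" and v = 0])
    fix v t'' and \<mu>'' :: "'k mem"
    assume v: "v < J" and a: "t'' = t \<and> newton_state 0 \<mu>'' \<and> \<mu>'' (Work, 5) = Ptr (2 ^ v)"
    have "(2::nat) ^ Suc v \<le> 2 ^ J" using v by (intro power_increasing) auto
    with J have le: "2 * 2 ^ v \<le> K" by simp
    have "runs (lay n) (Do (Point (reg 5) (PBin PTimes (wreg 5) (Num 2)))) t'' \<mu>''
      (\<lambda>t' \<mu>'. t' = t \<and> newton_state 0 \<mu>' \<and> \<mu>' (Work, 5) = Ptr (2 ^ Suc v))"
      by (rule runs_Do[OF step_Point[where p = "2 ^ Suc v"]]) (use a le K4 in \<open>auto simp: defs\<close>)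
    then show "(\<exists>a b. peval (lay n) \<mu>'' (PBin PTimes (wreg 5) (Num 2)) = Some a \<and>
        peval (lay n) \<mu>'' (padd (wreg 1) (Num 1)) = Some b \<and> a < b) \<and>
      runs (lay n) (Do (Point (reg 5) (PBin PTimes (wreg 5) (Num 2)))) t'' \<mu>''
      (\<lambda>t' \<mu>'. t' = t \<and> newton_state 0 \<mu>' \<and> \<mu>' (Work, 5) = Ptr (2 ^ Suc v))"
      using a le by (auto simp: defs)
  qed (use that J in \<open>auto simp: defs\<close>)
  \<comment> \<open>The 1 is the right-hand side of row 0, which the row then only divides by
    \<open>g 0\<close>.\<close>
  have p2: "runs (lay n) (Do (Load (Addr Out (Num 0)) 1)) t' \<mu>'
      (\<lambda>t' \<mu>'. t' = t \<and> newton_state 0 \<mu>' \<and> \<mu>' (Work, 5) = Ptr (2 ^ J) \<and> \<mu>' (Out, 0) = Coef 1)"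
    if "t' = t \<and> newton_state 0 \<mu>' \<and> \<mu>' (Work, 5) = Ptr (2 ^ J)" for t' \<mu>'
    by (rule runs_Do[where \<mu>' = "\<mu>'((Out, 0) := Coef 1)"]) (use that n in \<open>auto simp: defs store_def\<close>)
  have p3: "runs (lay n) (Do (Point (reg 2) (Num 0))) t' \<mu>'
      (\<lambda>t' \<mu>'. t' = t \<and> newton_state 0 \<mu>' \<and> \<mu>' (Work, 5) = Ptr (2 ^ J) \<and> \<mu>' (Out, 0) = Coef 1 \<and> \<mu>' (Work, 2) = Ptr 0)"
    if "t' = t \<and> newton_state 0 \<mu>' \<and> \<mu>' (Work, 5) = Ptr (2 ^ J) \<and> \<mu>' (Out, 0) = Coef 1" for t' \<mu>'
    by (rule runs_Do[OF step_Point[where p = 0]]) (use that in \<open>auto simp: defs\<close>)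
  have p4: "runs (lay n) (row Out) t' \<mu>'
      (\<lambda>t' \<mu>'. t' = t + 1 \<and> newton_state 1 \<mu>' \<and> \<mu>' (Work, 5) = Ptr (2 ^ J))"
    if "t' = t \<and> newton_state 0 \<mu>' \<and> \<mu>' (Work, 5) = Ptr (2 ^ J) \<and> \<mu>' (Out, 0) = Coef 1 \<and> \<mu>' (Work, 2) = Ptr 0" for t' \<mu>'
  proof -
    have "runs (lay n) (row Out) t' \<mu>' (\<lambda>t'' \<mu>''. t'' = t' + 2 * 0 + 1 \<and>
        \<mu>'' (Out, 0) = Coef (u 0) \<and>
        (\<forall>l'. l' \<notin> {(Work, 4), (Work, 6), (Out, 0)} \<longrightarrow> \<mu>'' l' = \<mu>' l'))"
      by (rule runs_row[where g = g]) (use that unit n u_sum[of 0] in \<open>auto simp: defs\<close>)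
    then show ?thesis by (rule runs_mono) (use that in \<open>auto simp: defs\<close>)
  qed
  define I where "I v t' \<mu>' \<longleftrightarrow> newton_state (K div 2 ^ (J - v)) \<mu>' \<and> \<mu>' (Work, 0) = Ptr (K div 2 ^ (J - v)) \<and>
    \<mu>' (Work, 5) = Ptr (2 ^ (J - v)) \<and> real t' \<le> real t + real (K div 2 ^ (J - v)) * A"
    for v t' and \<mu>' :: "'k mem"
  \<comment> \<open>This slack pays for the single division that produced
    \<open>u 0\<close>.\<close>
  have A: "6 \<le> A" using T0 by (simp add: A_def)
  have KJ: "K div 2 ^ J = 1"
  proof -
    have "K div 2 ^ J < 2" "0 < K div 2 ^ J"
      using J by (auto simp: less_mult_imp_div_less div_greater_zero_iff mult.commute)
    then show ?thesis by linarith
  qed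
  have p5: "runs (lay n) (Do (Point (reg 0) (Num 1))) t' \<mu>' (I 0)"
    if "t' = t + 1 \<and> newton_state 1 \<mu>' \<and> \<mu>' (Work, 5) = Ptr (2 ^ J)" for t' \<mu>'
    by (rule runs_Do[OF step_Point[where p = 1]]) (use that KJ A in \<open>auto simp: defs I_def\<close>)
  have p6: "runs (lay n) (Loop (Num 1) (wreg 5) (newton_body MP SP)) t' \<mu>' (I J)" if "I 0 t' \<mu>'" for t' \<mu>'
  proof (rule runs_Loop[where I = I, OF that])
    fix v t'' and \<mu>'' :: "'k mem"
    assume v: "v < J" and a: "I v t'' \<mu>''"
    define d :: nat where "d = 2 ^ (J - Suc v)"
    have d: "2 ^ (J - v) = 2 * d" using v by (simp add: d_def Suc_diff_Suc flip: power_Suc)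
    have "(2::nat) ^ (J - v) \<le> 2 ^ J" by (intro power_increasing) auto
    with J d have dK: "2 * d \<le> K" by simp
    have d1: "1 \<le> d" by (simp add: d_def)
    let ?l = "K div (2 * d)"
    have l1: "1 \<le> ?l" using dK d1 by (simp add: Suc_le_eq div_greater_zero_iff)
    have "?l = K div d div 2" by (simp add: div_mult2_eq mult.commute)
    then have l2: "2 * ?l \<le> K div d" by linarith
    have "Tm ?l + Ts ?l + 6 * real ?l \<le> real ?l * A"
      using Tm[OF l1] Ts[OF l1] by (simp add: A_def algebra_simps add_divide_distrib)
    moreover have "real ?l * A + real ?l * A \<le> real (K div d) * A"
      using mult_right_mono[of "2 * real ?l" "real (K div d)" A] l2 A by simp
    ultimately have le: "real ?l * A + (Tm ?l + Ts ?l + 6 * real ?l) \<le> real (K div d) * A" by linarith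
    have "runs (lay n) (newton_body MP SP) t'' \<mu>'' (\<lambda>t' \<mu>'. newton_state (K div d) \<mu>' \<and>
      \<mu>' (Work, 0) = Ptr (K div d) \<and> \<mu>' (Work, 5) = Ptr d \<and>
      real t' \<le> real t'' + Tm ?l + Ts ?l + 6 * real ?l)"
      by (rule runs_newton_body[OF d1 dK]) (use a in \<open>auto simp: I_def d\<close>)
    then have "runs (lay n) (newton_body MP SP) t'' \<mu>'' (I (Suc v))"
      by (rule runs_mono) (use a le in \<open>auto simp: I_def d d_def[symmetric]\<close>)
    then show "(\<exists>a b. peval (lay n) \<mu>'' (Num 1) = Some a \<and> peval (lay n) \<mu>'' (wreg 5) = Some b \<and> a < b) \<and>
      runs (lay n) (newton_body MP SP) t'' \<mu>'' (I (Suc v))"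
      using a d1 by (auto simp: I_def d)
  qed (auto simp: I_def)
  have "runs (lay n) (newton_prog MP SP) t \<mu> (I J)"
    unfolding newton_prog_def
    by (rule runs_Seq[OF p0], rule runs_Seq, erule p1, rule runs_Seq, erule p2, rule runs_Seq,
        erule p3, rule runs_Seq, erule p4, rule runs_Seq, erule p5, erule p6)
  moreover have "real K * A = Tm K + Ts K + 6 * real K"
    using K by (simp add: A_def field_simps)
  ultimately show ?thesis
    by (elim runs_mono) (auto simp: I_def)
qed

section \<open>Block elimination in the dividend\<close>

text \<open>For \<open>j >= a\<close>, this is coefficient \<open>j\<close> of
  \<open>f - (q mod X^a) * g\<close>.\<close>

definition res :: "nat \<Rightarrow> nat \<Rightarrow> 'k" where
  "res a j = f j - (\<Sum>s<a. q s * g (j - s))"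

text \<open>The subtracted sum is a coefficient of a block of \<open>q\<close> times a window of
  \<open>g\<close>, which a middle product provides.\<close>

lemma res_add: "res (a + K) j = res a j - (\<Sum>s<K. q (a + s) * g (j - (a + s)))"
proof -
  have "(\<Sum>s<a + K. q s * g (j - s)) = (\<Sum>s<a. q s * g (j - s)) + (\<Sum>s<K. q (a + s) * g (j - (a + s)))"
    by (induction K) (auto simp: algebra_simps)
  then show ?thesis by (simp add: res_def)
qed

text \<open>Every block of \<open>q\<close> is thus a short product of the residual with the same
  \<open>u\<close>: one inverse serves all blocks.\<close>

lemma q_res: "q (a + t) = (\<Sum>s\<le>t. res a (a + (t - s)) * u s)"
  unfolding res_def by (rule q_block)

text \<open>In the state below, \<open>Q\<close> is known up to \<open>b\<close>; its first \<open>a\<close> coefficients have been eliminated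
  from all rows below \<open>h K\<close>, and its first \<open>b\<close> coefficients from the rows below \<open>c\<close>.\<close>

definition block_state :: "nat \<Rightarrow> nat \<Rightarrow> nat \<Rightarrow> 'k mem \<Rightarrow> bool" where
  "block_state a b c \<mu> \<longleftrightarrow> \<mu> (Work, 0) = Ptr K \<and> \<mu> (Work, 1) = Ptr K \<and> \<mu> (Work, 2) = Ptr a \<and>
     (\<forall>j<n. \<mu> (Arg2, j) = Coef (g j)) \<and> (\<forall>j<K. \<mu> (Out, j) = Coef (u j)) \<and>
     (\<forall>j<n. \<mu> (Arg1, j) = Coef (if j < b then q j else if j < c then res b j
        else if j < h * K then res a j else f j))"

lemma runs_update:
  assumes S: "block_state a (a + K) b \<mu>" "\<mu> (Work, 3) = Ptr b"
    and b: "a + K \<le> b" "b + K \<le> h * K"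
  shows "runs (lay n) (update MP) t \<mu> (\<lambda>t' \<mu>'. block_state a (a + K) (b + K) \<mu>' \<and> \<mu>' (Work, 3) = Ptr (b + K) \<and>
    real t' \<le> real t + Tm K + real K)"
proof -
  \<comment> \<open>This start makes \<open>?oA + (K - 1) = b - a\<close>, so that entry
    \<open>i\<close> of the middle product meets \<open>g (b + i - (a + s))\<close>. The truncated
    subtraction is exact because \<open>a + K <= b\<close>.\<close>
  let ?oA = "b - a - K + 1"
  define E where "E i = (\<Sum>s<K. q (a + s) * g (b + i - (a + s)))" for i
  have E: "(\<Sum>s<K. q (a + s) * g (?oA + (K - 1 + i - s))) = E i" for i
    unfolding E_def
  proof (rule sum.cong)
    fix s assume "s \<in> {..<K}"
    then have eq: "?oA + (K - 1 + i - s) = b + i - (a + s)" using b by auto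
    show "q (a + s) * g (?oA + (K - 1 + i - s)) = q (a + s) * g (b + i - (a + s))" unfolding eq ..
  qed simp
  note defs = block_state_def
  have p1: "runs (lay n) (call Arg2 (padd (PBin PMinus (PBin PMinus (wreg 3) (wreg 2)) (wreg 1)) (Num 1)) Arg1 (wreg 2) (wreg 1) MP) t \<mu>
    (\<lambda>t' \<mu>'. block_state a (a + K) b \<mu>' \<and> \<mu>' (Work, 3) = Ptr b \<and> (\<forall>i<K. \<mu>' (Out, K + i) = Coef (E i)) \<and>
      real t' \<le> real t + Tm K)"
  proof -
    have "runs (lay n) (call Arg2 (padd (PBin PMinus (PBin PMinus (wreg 3) (wreg 2)) (wreg 1)) (Num 1)) Arg1 (wreg 2) (wreg 1) MP) t \<mu>
      (\<lambda>t' \<mu>'. real t' \<le> real t + Tm K \<and>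
      (\<forall>i<K. \<mu>' (Out, K + i) = Coef (\<Sum>s<K. q (a + s) * g (?oA + (K - 1 + i - s)))) \<and>
      (\<forall>l. fst l \<noteq> Out \<or> snd l < K \<longrightarrow> \<mu>' l = \<mu> l))"
      by (rule runs_MP[where oB = a]) (use S b K hK in \<open>auto simp: defs\<close>)
    then show ?thesis unfolding E by (rule runs_mono) (use S in \<open>auto simp: defs\<close>)
  qed
  let ?i = "Arith (Addr Arg1 (padd (wreg 3) (wreg 4))) KMinus
    (Addr Arg1 (padd (wreg 3) (wreg 4))) (Addr Out (padd (wreg 1) (wreg 4))) :: 'k instr"
  have p2: "runs (lay n) (vec (wreg 1) ?i) t' \<mu>' (\<lambda>t' \<mu>'. block_state a (a + K) (b + K) \<mu>' \<and>
      \<mu>' (Work, 3) = Ptr b \<and> real t' \<le> real t + Tm K + real K)"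
    if a: "block_state a (a + K) b \<mu>' \<and> \<mu>' (Work, 3) = Ptr b \<and> (\<forall>i<K. \<mu>' (Out, K + i) = Coef (E i)) \<and>
      real t' \<le> real t + Tm K" for t' \<mu>'
  proof -
    have "runs (lay n) (vec (wreg 1) ?i) t' \<mu>' (\<lambda>t'' \<mu>''. t'' = t' + K * cost ?i \<and>
      (\<forall>s<K. \<mu>'' (Arg1, b + s) = Coef (res (a + K) (b + s))) \<and>
      (\<forall>l'. l' \<noteq> (Work, 4) \<longrightarrow> (\<forall>j<K. l' \<noteq> (Arg1, b + j)) \<longrightarrow> \<mu>'' l' = \<mu>' l'))"
    proof (rule runs_vec)
      fix s \<mu>''
      assume s: "s < K" "\<mu>'' (Work, 4) = Ptr s"
        and fr: "\<And>l. l \<noteq> (Work, 4) \<Longrightarrow> (\<And>j. j < s \<Longrightarrow> l \<noteq> (Arg1, b + j)) \<Longrightarrow> \<mu>'' l = \<mu>' l"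
      have "\<mu>' (Arg1, b + s) = Coef (res a (b + s))"
        using a s b hK by (auto simp: defs)
      then have "\<mu>'' (Arg1, b + s) = Coef (res a (b + s))" using fr by auto
      moreover have "\<mu>'' (Out, K + s) = Coef (E s)" using fr a s by auto
      moreover have "\<mu>'' (Work, 1) = Ptr K" "\<mu>'' (Work, 3) = Ptr b" using fr a by (auto simp: defs)
      ultimately show "step (lay n) ?i \<mu>'' = Some (\<mu>''((Arg1, b + s) := Coef (res (a + K) (b + s))))"
        using s b hK K4 by (auto simp: fetch_def store_def res_add E_def)
    qed (use a K4 in \<open>auto simp: defs\<close>)
    then show ?thesis
    proof (rule runs_mono)
      fix t'' \<mu>''
      assume c: "t'' = t' + K * cost ?i \<and>
        (\<forall>s<K. \<mu>'' (Arg1, b + s) = Coef (res (a + K) (b + s))) \<and>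
        (\<forall>l'. l' \<noteq> (Work, 4) \<longrightarrow> (\<forall>j<K. l' \<noteq> (Arg1, b + j)) \<longrightarrow> \<mu>'' l' = \<mu>' l')"
      have "\<mu>'' (Arg1, j) = Coef (if j < a + K then q j else if j < b + K then res (a + K) j
        else if j < h * K then res a j else f j)" if "j < n" for j
      proof (cases "b \<le> j \<and> j < b + K")
        case True
        then have "\<mu>'' (Arg1, b + (j - b)) = Coef (res (a + K) (b + (j - b)))"
          using c by (metis less_diff_conv2 add.commute)
        then show ?thesis using True b by auto
      next
        case False
        then have "\<mu>'' (Arg1, j) = \<mu>' (Arg1, j)" using c by auto
        then show ?thesis using a that False b by (auto simp: defs)
      qed
      then show "block_state a (a + K) (b + K) \<mu>'' \<and> \<mu>'' (Work, 3) = Ptr b \<and> real t'' \<le> real t + Tm K + real K"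
        using a c by (auto simp: defs)
    qed
  qed
  have p3: "runs (lay n) (Do (Point (reg 3) (padd (wreg 3) (wreg 1)))) t' \<mu>'
      (\<lambda>t' \<mu>'. block_state a (a + K) (b + K) \<mu>' \<and> \<mu>' (Work, 3) = Ptr (b + K) \<and> real t' \<le> real t + Tm K + real K)"
    if "block_state a (a + K) (b + K) \<mu>' \<and> \<mu>' (Work, 3) = Ptr b \<and> real t' \<le> real t + Tm K + real K" for t' \<mu>'
    by (rule runs_Do[OF step_Point[where p = "b + K"]]) (use that b hK in \<open>auto simp: defs\<close>)
  show ?thesis
    unfolding update_def by (rule runs_Seq[OF p1], rule runs_Seq, erule p2, erule p3)
qed

text \<open>Only the short product takes time, as copying costs no arithmetic. No later row has been
  updated yet, so both limits become \<open>a + K\<close>.\<close>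

lemma runs_solve_block:
  assumes S: "block_state a a (h * K) \<mu>" and a: "a + K \<le> h * K"
  shows "runs (lay n) (solve_block SP) t \<mu> (\<lambda>t' \<mu>'. block_state a (a + K) (a + K) \<mu>' \<and> real t' \<le> real t + Ts K)"
proof -
  note defs = block_state_def
  have p1: "runs (lay n) (call Arg1 (wreg 2) Out (Num 0) (wreg 1) SP) t \<mu>
    (\<lambda>t' \<mu>'. block_state a a (h * K) \<mu>' \<and> (\<forall>i<K. \<mu>' (Out, K + i) = Coef (q (a + i))) \<and> real t' \<le> real t + Ts K)"
  proof -
    have "runs (lay n) (call Arg1 (wreg 2) Out (Num 0) (wreg 1) SP) t \<mu> (\<lambda>t' \<mu>'. real t' \<le> real t + Ts K \<and>
      (\<forall>i<K. \<mu>' (Out, K + i) = Coef (\<Sum>s\<le>i. res a (a + (i - s)) * u s)) \<and>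
      (\<forall>l'. fst l' \<noteq> Out \<or> snd l' < K \<longrightarrow> \<mu>' l' = \<mu> l'))"
      by (rule runs_SP[where oA = a]) (use S a K hK in \<open>auto simp: defs\<close>)
    then show ?thesis unfolding q_res[symmetric] by (rule runs_mono) (use S in \<open>auto simp: defs\<close>)
  qed
  let ?i = "Move (Addr Arg1 (padd (wreg 2) (wreg 4))) (Addr Out (padd (wreg 1) (wreg 4))) :: 'k instr"
  have p2: "runs (lay n) (vec (wreg 1) ?i) t' \<mu>' (\<lambda>t' \<mu>'. block_state a (a + K) (a + K) \<mu>' \<and> real t' \<le> real t + Ts K)"
    if b: "block_state a a (h * K) \<mu>' \<and> (\<forall>i<K. \<mu>' (Out, K + i) = Coef (q (a + i))) \<and> real t' \<le> real t + Ts K" for t' \<mu>'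
  proof -
    have "runs (lay n) (vec (wreg 1) ?i) t' \<mu>' (\<lambda>t'' \<mu>''. t'' = t' + K * cost ?i \<and>
      (\<forall>s<K. \<mu>'' (Arg1, a + s) = Coef (q (a + s))) \<and>
      (\<forall>l'. l' \<noteq> (Work, 4) \<longrightarrow> (\<forall>j<K. l' \<noteq> (Arg1, a + j)) \<longrightarrow> \<mu>'' l' = \<mu>' l'))"
      by (rule runs_vec) (use a b hK K4 in \<open>auto simp: defs fetch_def store_def\<close>)
    then show ?thesis
    proof (rule runs_mono)
      fix t'' \<mu>''
      assume c: "t'' = t' + K * cost ?i \<and>
        (\<forall>s<K. \<mu>'' (Arg1, a + s) = Coef (q (a + s))) \<and>
        (\<forall>l'. l' \<noteq> (Work, 4) \<longrightarrow> (\<forall>j<K. l' \<noteq> (Arg1, a + j)) \<longrightarrow> \<mu>'' l' = \<mu>' l')"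
      have "\<mu>'' (Arg1, j) = Coef (if j < a + K then q j else if j < a + K then res (a + K) j
        else if j < h * K then res a j else f j)" if "j < n" for j
      proof (cases "a \<le> j \<and> j < a + K")
        case True
        then have "\<mu>'' (Arg1, a + (j - a)) = Coef (q (a + (j - a)))"
          using c by (metis less_diff_conv2 add.commute)
        then show ?thesis using True by auto
      next
        case False
        then have "\<mu>'' (Arg1, j) = \<mu>' (Arg1, j)" using c by auto
        then show ?thesis using b that False a by (auto simp: defs)
      qed
      then show "block_state a (a + K) (a + K) \<mu>'' \<and> real t'' \<le> real t + Ts K"
        using b c by (auto simp: defs)
    qed
  qed
  show ?thesis
    unfolding solve_block_def by (rule runs_Seq[OF p1], erule p2)
qed

text \<open>Block \<open>v\<close>, counted from 0, takes one short product and
  \<open>h - 1 - v\<close> updates, each with \<open>K\<close> subtractions besides its middle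
  product.\<close>

lemma runs_blocks:
  assumes S: "newton_state K \<mu>" "\<mu> (Work, 0) = Ptr K"
  shows "runs (lay n) (blocks_prog h MP SP) t \<mu> (\<lambda>t' \<mu>'. block_state (h * K) (h * K) (h * K) \<mu>' \<and>
    real t' \<le> real t + real h * Ts K + real h * (real h - 1) / 2 * (Tm K + real K))"
proof -
  note defs = block_state_def
  \<comment> \<open>The factor \<open>v * (2 * h - 1 - v) / 2\<close> is the sum of
    \<open>h - 1 - i\<close> over \<open>i < v\<close>, the number of updates made for the first
    \<open>v\<close> blocks.\<close>
  define I where "I v t' \<mu>' \<longleftrightarrow> block_state (v * K) (v * K) (h * K) \<mu>' \<and>
    real t' \<le> real t + real v * Ts K + real v * (2 * real h - 1 - real v) / 2 * (Tm K + real K)"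
    for v t' and \<mu>' :: "'k mem"
  have p0: "runs (lay n) (Do (Point (reg 2) (Num 0))) t \<mu> (I 0)"
    by (rule runs_Do[OF step_Point[where p = 0]]) (use S in \<open>auto simp: I_def defs res_def newton_state_def\<close>)
  let ?body = "Seq (solve_block SP)
       (Seq (Do (Point (reg 3) (padd (wreg 2) (wreg 1))))
       (Seq (Loop (wreg 3) (PBin PTimes (Num h) (wreg 1)) (update MP))
            (Do (Point (reg 2) (padd (wreg 2) (wreg 1))))))"
  have p1: "runs (lay n) (Loop (wreg 2) (PBin PTimes (Num h) (wreg 1)) ?body) t' \<mu>' (I h)" if "I 0 t' \<mu>'" for t' \<mu>'
  proof (rule runs_Loop[where I = I, OF that])
    fix v t1 and \<mu>1 :: "'k mem"
    assume v: "v < h" and a: "I v t1 \<mu>1"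
    have le: "b * K + K \<le> h * K" if "b < h" for b
      using mult_le_mono1[of "Suc b" h K] that by simp
    have q1: "runs (lay n) (solve_block SP) t1 \<mu>1 (\<lambda>t' \<mu>'. block_state (v * K) (v * K + K) (v * K + K) \<mu>' \<and> real t' \<le> real t1 + Ts K)"
      by (rule runs_solve_block) (use a le[OF v] in \<open>auto simp: I_def\<close>)
    define I' where "I' b t' \<mu>' \<longleftrightarrow> block_state (v * K) (v * K + K) (b * K) \<mu>' \<and> \<mu>' (Work, 3) = Ptr (b * K) \<and>
      v < b \<and> real t' \<le> real t1 + Ts K + (real b - real v - 1) * (Tm K + real K)" for b t' and \<mu>' :: "'k mem"
    have q2: "runs (lay n) (Do (Point (reg 3) (padd (wreg 2) (wreg 1)))) t' \<mu>' (I' (Suc v))"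
      if "block_state (v * K) (v * K + K) (v * K + K) \<mu>' \<and> real t' \<le> real t1 + Ts K" for t' \<mu>'
      by (rule runs_Do[OF step_Point[where p = "v * K + K"]])
        (use that le[OF v] hK in \<open>auto simp: I'_def defs add.commute\<close>)
    have q3: "runs (lay n) (Loop (wreg 3) (PBin PTimes (Num h) (wreg 1)) (update MP)) t' \<mu>' (I' h)"
      if "I' (Suc v) t' \<mu>'" for t' \<mu>'
    proof (rule runs_Loop[where I = I', OF that])
      fix b t2 and \<mu>2 :: "'k mem"
      assume b: "b < h" and c: "I' b t2 \<mu>2"
      have vb: "v * K + K \<le> b * K" using mult_le_mono1[of "Suc v" b K] c by (simp add: I'_def)
      have "runs (lay n) (update MP) t2 \<mu>2 (\<lambda>t' \<mu>'. block_state (v * K) (v * K + K) (b * K + K) \<mu>' \<and>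
        \<mu>' (Work, 3) = Ptr (b * K + K) \<and> real t' \<le> real t2 + Tm K + real K)"
        by (rule runs_update) (use c vb le[OF b] in \<open>auto simp: I'_def\<close>)
      then have "runs (lay n) (update MP) t2 \<mu>2 (I' (Suc b))"
        by (rule runs_mono) (use c in \<open>auto simp: I'_def add.commute algebra_simps\<close>)
      then show "(\<exists>a b. peval (lay n) \<mu>2 (wreg 3) = Some a \<and>
        peval (lay n) \<mu>2 (PBin PTimes (Num h) (wreg 1)) = Some b \<and> a < b) \<and> runs (lay n) (update MP) t2 \<mu>2 (I' (Suc b))"
        using c b K by (auto simp: I'_def defs)
    qed (use v in \<open>auto simp: I'_def defs\<close>)
    have q4: "runs (lay n) (Do (Point (reg 2) (padd (wreg 2) (wreg 1)))) t' \<mu>' (I (Suc v))"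
      if c: "I' h t' \<mu>'" for t' \<mu>'
    proof (rule runs_Do[OF step_Point[where p = "v * K + K"]])
      have "real v * (2 * real h - 1 - real v) / 2 + (real h - real v - 1)
          = real (Suc v) * (2 * real h - 1 - real (Suc v)) / 2"
        by (simp add: field_simps)
      then have "real v * (2 * real h - 1 - real v) / 2 * (Tm K + real K) + (real h - real v - 1) * (Tm K + real K)
          = real (Suc v) * (2 * real h - 1 - real (Suc v)) / 2 * (Tm K + real K)"
        by (metis distrib_right)
      moreover have "real (Suc v) * Ts K = real v * Ts K + Ts K" by (simp add: algebra_simps)
      ultimately have "real t' \<le> real t + real (Suc v) * Ts K
          + real (Suc v) * (2 * real h - 1 - real (Suc v)) / 2 * (Tm K + real K)"
        using a c unfolding I_def I'_def by linarith
      moreover have "block_state (Suc v * K) (Suc v * K) (h * K) (\<mu>'((Work, 2) := Ptr (v * K + K)))"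
        using c le[OF v] by (auto simp: I'_def defs add.commute)
      ultimately show "I (Suc v) (t' + cost (Point (reg 2) (padd (wreg 2) (wreg 1)))) (\<mu>'((Work, 2) := Ptr (v * K + K)))"
        unfolding I_def by simp
    qed (use c le[OF v] hK in \<open>auto simp: I'_def defs\<close>)
    have "runs (lay n) ?body t1 \<mu>1 (I (Suc v))"
      by (rule runs_Seq[OF q1], rule runs_Seq, erule q2, rule runs_Seq, erule q3, erule q4)
    then show "(\<exists>a b. peval (lay n) \<mu>1 (wreg 2) = Some a \<and>
        peval (lay n) \<mu>1 (PBin PTimes (Num h) (wreg 1)) = Some b \<and> a < b) \<and> runs (lay n) ?body t1 \<mu>1 (I (Suc v))"
      using a v K by (auto simp: I_def defs)
  qed (auto simp: I_def defs)
  have "runs (lay n) (blocks_prog h MP SP) t \<mu> (I h)"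
    unfolding blocks_prog_def by (rule runs_Seq[OF p0], erule p1)
  then show ?thesis by (rule runs_mono) (auto simp: I_def)
qed

end

section \<open>The complete program\<close>

text \<open>Below the threshold \<open>n0\<close> the block size is 0 and the naive rows do all the
  work. The quotient forms in the dividend, since \<open>Out\<close> is scratch until the end; the
  final copy costs no arithmetic.\<close>

definition division_prog :: "nat \<Rightarrow> nat \<Rightarrow> 'k::comm_ring_1 prog \<Rightarrow> 'k prog \<Rightarrow> 'k prog" where
  "division_prog n0 h MP SP =
     Seq (Cond Size (Num n0) (Do (Point (reg 1) (Num 0)))
       (Seq (Do (Point (reg 1) (PBin PDiv Size (Num h))))
       (Seq (newton_prog MP SP) (blocks_prog h MP SP))))
    (Seq (naive_prog h)
         (vec Size (Move (Addr Out (wreg 4)) (Addr Arg1 (wreg 4)))))"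

text \<open>\<open>T\<close> bounds the time spent before the naive rows. Blocked division requires
  \<open>K >= 1\<close>, so its locale enters as a premise of the large case only.\<close>

lemma (in division) runs_division:
  assumes G: "\<And>j. j < n \<Longrightarrow> \<mu> (Arg2, j) = Coef (g j)"
    and F: "\<And>j. j < n \<Longrightarrow> \<mu> (Arg1, j) = Coef (f j)"
    and small: "n < n0 \<Longrightarrow> K = 0 \<and> 0 \<le> T"
    and large: "\<not> n < n0 \<Longrightarrow> block_division n g f q u h K MP SP wm ws Tm Ts \<and> K = n div h \<and>
      Tm K + Ts K + 6 * real K + real h * Ts K + real h * (real h - 1) / 2 * (Tm K + real K) \<le> T"
  shows "runs (lay n) (division_prog n0 h MP SP) 0 \<mu> (\<lambda>t' \<mu>'.
    real t' \<le> T + real ((n - h * K) * (2 * n)) \<and> (\<forall>j<n. \<mu>' (Out, j) = Coef (q j)))"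
proof -
  define P1 where "P1 = Cond Size (Num n0) (Do (Point (reg 1) (Num 0)))
       (Seq (Do (Point (reg 1) (PBin PDiv Size (Num h))))
       (Seq (newton_prog MP SP) (blocks_prog h MP SP)))"
  define A where "A t' \<mu>' \<longleftrightarrow> real t' \<le> T \<and> \<mu>' (Work, 1) = Ptr K \<and> (\<forall>j<n. \<mu>' (Arg2, j) = Coef (g j)) \<and>
     (\<forall>j<n. \<mu>' (Arg1, j) = Coef (if j < h * K then q j else f j))" for t' and \<mu>' :: "'k mem"
  have p1: "runs (lay n) P1 0 \<mu> A"
    unfolding P1_def
  proof (rule runs_Cond[where a = n and b = n0])
    assume "n < n0"
    with small have "K = 0" "0 \<le> T" by auto
    then show "runs (lay n) (Do (Point (reg 1) (Num 0))) 0 \<mu> A"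
      by (intro runs_Do[OF step_Point[where p = 0]]) (use G F in \<open>auto simp: A_def\<close>)
  next
    assume n0: "\<not> n < n0"
    then interpret block_division n g f q u h K MP SP wm ws Tm Ts using large by blast
    have Kn: "K = n div h" using large n0 by blast
    have q1: "runs (lay n) (Do (Point (reg 1) (PBin PDiv Size (Num h)))) 0 \<mu> (\<lambda>t' \<mu>'. t' = 0 \<and> newton_state 0 \<mu>')"
      by (rule runs_Do[OF step_Point[where p = K]]) (use G F K4 in \<open>auto simp: newton_state_def Kn[symmetric]\<close>)
    have q2: "runs (lay n) (newton_prog MP SP) t' \<mu>' (\<lambda>t' \<mu>'. newton_state K \<mu>' \<and> \<mu>' (Work, 0) = Ptr K \<and>
      real t' \<le> real 0 + Tm K + Ts K + 6 * real K)" if "t' = 0 \<and> newton_state 0 \<mu>'" for t' \<mu>'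
      using runs_newton[of \<mu>' t'] that by simp
    have q3: "runs (lay n) (blocks_prog h MP SP) t' \<mu>' A"
      if a: "newton_state K \<mu>' \<and> \<mu>' (Work, 0) = Ptr K \<and> real t' \<le> real 0 + Tm K + Ts K + 6 * real K" for t' \<mu>'
    proof (rule runs_mono[OF runs_blocks[of \<mu>' t']])
      fix t'' \<mu>''
      assume b: "block_state (h * K) (h * K) (h * K) \<mu>'' \<and>
        real t'' \<le> real t' + real h * Ts K + real h * (real h - 1) / 2 * (Tm K + real K)"
      have "real t'' \<le> T" using b a large n0 by fastforce
      then show "A t'' \<mu>''" using b by (auto simp: A_def block_state_def)
    qed (use a in auto)
    show "runs (lay n) (Seq (Do (Point (reg 1) (PBin PDiv Size (Num h))))
       (Seq (newton_prog MP SP) (blocks_prog h MP SP))) 0 \<mu> A"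
      by (rule runs_Seq[OF q1], rule runs_Seq, erule q2, erule q3)
  qed auto
  have hKn: "h * K \<le> n" using small large by (cases "n < n0") auto
  let ?T = "T + real ((n - h * K) * (2 * n))"
  have p2: "runs (lay n) (naive_prog h) t' \<mu>' (\<lambda>t' \<mu>'. real t' \<le> ?T \<and> (\<forall>j<n. \<mu>' (Arg1, j) = Coef (q j)))"
    if a: "A t' \<mu>'" for t' \<mu>'
  proof (rule runs_mono[OF runs_naive[of \<mu>' K h t', OF _ hKn]])
    fix t'' \<mu>''
    assume b: "t'' \<le> t' + (n - h * K) * (2 * n) \<and> (\<forall>j<n. \<mu>'' (Arg1, j) = Coef (q j))"
    then have "real t'' \<le> real (t' + (n - h * K) * (2 * n))" using of_nat_mono by blast
    then have "real t'' \<le> ?T" using a unfolding A_def by (simp del: of_nat_mult)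
    with b show "real t'' \<le> ?T \<and> (\<forall>j<n. \<mu>'' (Arg1, j) = Coef (q j))" by blast
  qed (use a in \<open>auto simp: A_def\<close>)
  let ?i = "Move (Addr Out (wreg 4)) (Addr Arg1 (wreg 4)) :: 'k instr"
  have p3: "runs (lay n) (vec Size ?i) t' \<mu>' (\<lambda>t' \<mu>'. real t' \<le> ?T \<and> (\<forall>j<n. \<mu>' (Out, j) = Coef (q j)))"
    if a: "real t' \<le> ?T \<and> (\<forall>j<n. \<mu>' (Arg1, j) = Coef (q j))" for t' \<mu>'
  proof -
    have "runs (lay n) (vec Size ?i) t' \<mu>' (\<lambda>t'' \<mu>''. t'' = t' + n * cost ?i \<and>
      (\<forall>s<n. \<mu>'' (Out, 0 + s) = Coef (q s)) \<and>
      (\<forall>l'. l' \<noteq> (Work, 4) \<longrightarrow> (\<forall>j<n. l' \<noteq> (Out, 0 + j)) \<longrightarrow> \<mu>'' l' = \<mu>' l'))"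
      by (rule runs_vec) (use a in \<open>auto simp: fetch_def store_def\<close>)
    then show ?thesis by (rule runs_mono) (use a in auto)
  qed
  show ?thesis
    unfolding division_prog_def P1_def[symmetric]
    by (rule runs_Seq[OF p1], rule runs_Seq, erule p2, erule p3)
qed

section \<open>Estimates for time and space\<close>

text \<open>Some run starts from a memory full of zeros, and its operation count is a natural number
  at most \<open>T\<close>. The signs of the time bounds thus follow from the existence of the
  algorithms.\<close>

lemma computes_zero_nonneg:
  assumes "computes V P n a b r w (0 :: 'k::comm_ring_1 poly) 0 R T"
  shows "0 \<le> T"
proof -
  have "holds_poly (\<lambda>_. Coef (0 :: 'k)) Arg1 a 0" "holds_poly (\<lambda>_. Coef (0 :: 'k)) Arg2 b 0"
    by (auto simp: holds_poly_def)
  with assms obtain t :: nat where "real t \<le> T" unfolding computes_def by blast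
  then show ?thesis using of_nat_0_le_iff[of t, where ?'a = real] by linarith
qed

lemma mult_time_bound_nonneg:
  assumes "mult_time_bound TYPE('k::comm_ring_1) M" "1 \<le> n"
  shows "0 \<le> M n"
proof -
  obtain P :: "'k prog" and w where
    "\<And>n F G. 1 \<le> n \<Longrightarrow> degree F < n \<and> degree G < n \<Longrightarrow>
        computes {Out, Work} P n n n (2 * n - 1) (w n) F G (F * G) (M n)"
    using assms(1) unfolding mult_time_bound_def by blast
  from this[OF assms(2), of 0 0] assms(2) show ?thesis
    by (intro computes_zero_nonneg) auto
qed

text \<open>The constant \<open>lam\<close> may be negative, but only if \<open>M\<close> vanishes.\<close>

lemma scaled_time_bound:
  assumes M: "mult_time_bound TYPE('k::comm_ring_1) M"
    and nonneg: "\<And>n. 1 \<le> n \<Longrightarrow> 0 \<le> lam * M n" and m: "1 \<le> m" "m \<le> n"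
  shows "lam * M m \<le> real m * (lam * M n / real n)"
proof -
  have "(\<alpha>::real) \<ge> 1 \<and> k \<ge> 1 \<and> real l = \<alpha> * real k \<Longrightarrow> \<alpha> * M k \<le> M l" for \<alpha> k l
    using M unfolding mult_time_bound_def by blast
  from this[of "real n / real m" m n] have "(real n / real m) * M m \<le> M n"
    using m by simp
  then have le: "M m \<le> real m * (M n / real n)" using m by (simp add: field_simps)
  show ?thesis
  proof (cases "0 \<le> lam")
    case True
    from mult_left_mono[OF le this] show ?thesis by (simp add: algebra_simps)
  next
    case False
    then have "M k = 0" if "1 \<le> k" for k
      using nonneg[OF that] mult_time_bound_nonneg[OF M that] by (simp add: zero_le_mult_iff)
    then show ?thesis using m by simp
  qed
qed

text \<open>A negative slope would force a negative number of registers for large \<open>n\<close>.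
  This yields \<open>c >= 3\<close>, hence \<open>h >= 4\<close>.\<close>

lemma linear_space_nonneg:
  fixes w :: "nat \<Rightarrow> nat"
  assumes "\<And>n. 1 \<le> n \<Longrightarrow> real (w n) \<le> a * real n + d"
  shows "0 \<le> a"
proof (rule ccontr)
  assume "\<not> 0 \<le> a"
  then obtain n where n: "d < real n * (- a)" using reals_Archimedean3[of "- a"] by auto
  have "0 \<le> a * real (Suc n) + d"
    using assms[of "Suc n"] of_nat_0_le_iff[of "w (Suc n)", where ?'a = real] by simp
  with n \<open>\<not> 0 \<le> a\<close> show False by (simp add: algebra_simps)
qed

text \<open>From \<open>h * K <= n\<close> follow \<open>aK <= a / h\<close> and
  \<open>sK <= s / h\<close>. So \<open>h * (h - 1) / 2\<close> middle products cost at most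
  \<open>a * (h - 1) / 2 <= a * (c + 1) / 2\<close>, the \<open>h\<close> short products at most
  \<open>s\<close>, and the products for the inverse at most
  \<open>(a + s) / h <= (a + s) / c\<close>.\<close>

lemma division_cost_bound:
  fixes a s c :: real
  assumes a: "0 \<le> a" and s: "0 \<le> s" and c: "3 \<le> c" "c + 1 \<le> real h" "real h \<le> c + 2" and hK: "h * K \<le> n" and K: "1 \<le> K"
    and aK: "aK \<le> real K * (a / real n)" and sK: "sK \<le> real K * (s / real n)"
  shows "aK + sK + 6 * real K + real h * sK + real h * (real h - 1) / 2 * (aK + real K)
    \<le> a * ((c + 1) / 2 + 1 / c) + s * (1 + 1 / c) + (6 + real h) * real n"
proof -
  have h: "real h > 0" using c by linarith
  then have n: "real n > 0" using hK K by (metis le_zero_eq mult_eq_0_iff neq0_conv not_one_le_zero of_nat_0_less_iff)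
  have hKn: "real h * real K \<le> real n" using hK by (metis of_nat_le_iff of_nat_mult)
  have div: "y \<le> x / real h" if "y \<le> real K * (x / real n)" "0 \<le> x" for x y
  proof -
    have "real h * real K * x \<le> real n * x" using hKn that(2) by (rule mult_right_mono)
    then have "real K * (x / real n) \<le> x / real h" using h n by (simp add: field_simps)
    with that(1) show ?thesis by linarith
  qed
  have hc: "x / real h \<le> x * (1 / c)" if "0 \<le> x" for x
  proof -
    have "x / real h \<le> x / c" using that c by (intro divide_left_mono) auto
    then show ?thesis by simp
  qed
  have 1: "aK \<le> a * (1 / c)" using div[OF aK a] hc[OF a] by linarith
  have 2: "sK \<le> s * (1 / c)" using div[OF sK s] hc[OF s] by linarith
  have 3: "real h * sK \<le> s" using div[OF sK s] h by (simp add: field_simps)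
  have "real h * aK \<le> a" using div[OF aK a] h by (simp add: field_simps)
  then have "(real h - 1) / 2 * (real h * aK) \<le> (real h - 1) / 2 * a"
    using c by (intro mult_left_mono) auto
  also have "\<dots> \<le> (c + 1) / 2 * a" using c a by (intro mult_right_mono) auto
  finally have 4: "real h * (real h - 1) / 2 * aK \<le> a * ((c + 1) / 2)" by (simp add: algebra_simps)
  have "(real h - 1) / 2 * (real h * real K) \<le> real h * real n"
    using c hKn by (intro mult_mono) auto
  then have 5: "real h * (real h - 1) / 2 * real K \<le> real h * real n" by (simp add: algebra_simps)
  have "1 * real K \<le> real h * real K" using c by (intro mult_right_mono) auto
  then have 6: "real K \<le> real n" using hKn by linarith
  from 1 2 3 4 5 6 show ?thesis
    unfolding distrib_left distrib_right mult_1_right by linarith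
qed

section \<open>Choice of the parameters\<close>

theorem corollary2p6:
  fixes M :: "nat \<Rightarrow> real"
    and lam_m cm lam_s cs c :: real
    and MP SP :: "'k::comm_ring_1 prog"
  assumes "mult_time_bound TYPE('k) M"
    and "middle_product_algorithm M lam_m cm MP"
    and "short_product_algorithm M lam_s cs SP"
    and "c = max (cm + 3) (cs + 2)"
  shows "\<exists>(P :: 'k prog) (w :: nat) (C :: real).
           erasing_division_algorithm w
             (\<lambda>n. (lam_m * ((c + 1) / 2 + 1 / c) + lam_s * (1 + 1 / c)) * M n + C * real n) P"
proof -
  obtain wm dm where wm: "\<And>n. 1 \<le> n \<Longrightarrow> real (wm n) \<le> cm * real n + dm"
    and MP: "\<And>n F G. 1 \<le> n \<Longrightarrow> degree F < 2 * n - 1 \<Longrightarrow> degree G < n \<Longrightarrow>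
      computes {Out, Work} MP n (2 * n - 1) n n (wm n) F G (middle_product n n F G) (lam_m * M n)"
    using assms(2) unfolding middle_product_algorithm_def by blast
  obtain ws ds where ws: "\<And>n. 1 \<le> n \<Longrightarrow> real (ws n) \<le> cs * real n + ds"
    and SP: "\<And>n F G. 1 \<le> n \<Longrightarrow> degree F < n \<Longrightarrow> degree G < n \<Longrightarrow>
      computes {Out, Work} SP n n n n (ws n) F G (short_product n F G) (lam_s * M n)"
    using assms(3) unfolding short_product_algorithm_def by blast
  have cm: "0 \<le> cm" and cs: "0 \<le> cs"
    using linear_space_nonneg[OF wm] linear_space_nonneg[OF ws] by auto
  have c: "3 \<le> c" "cm + 3 \<le> c" "cs + 2 \<le> c" using assms(4) cm by auto
  have m0: "0 \<le> lam_m * M n" if "1 \<le> n" for n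
    using MP[OF that, of 0 0] that by (intro computes_zero_nonneg) auto
  have s0: "0 \<le> lam_s * M n" if "1 \<le> n" for n
    using SP[OF that, of 0 0] that by (intro computes_zero_nonneg) auto
  \<comment> \<open>\<open>h >= c + 1\<close> leaves at least \<open>c - 1\<close> blocks of
    \<open>Out\<close> as work space beside the inverse and the current product;
    \<open>h <= c + 2\<close> limits the number of middle products.\<close>
  define h where "h = nat \<lceil>c\<rceil> + 1"
  have h: "c + 1 \<le> real h" "real h \<le> c + 2" unfolding h_def using c(1) by linarith+
  have h4: "4 \<le> h" using h c(1) by linarith
  \<comment> \<open>For \<open>n >= h * D\<close> the block size is at least \<open>D\<close>, so
    one block of work space absorbs the additive constants \<open>dm\<close> and \<open>ds\<close>.
    The successor ensures \<open>K >= 1\<close>.\<close>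
  define D where "D = Suc (nat \<lceil>max dm ds\<rceil>)"
  have D: "dm \<le> real D" "ds \<le> real D" "1 \<le> D" unfolding D_def by linarith+
  define n0 where "n0 = h * D"
  define T where "T n = lam_m * M n * ((c + 1) / 2 + 1 / c) + lam_s * M n * (1 + 1 / c) + (6 + real h) * real n" for n
  \<comment> \<open>\<open>6 + h\<close> comes from the Newton iteration and the block updates, the
    rest from at most \<open>h + n0\<close> naive rows at \<open>2 * n\<close> operations
    each.\<close>
  define C where "C = 6 + real h + 2 * real h + 2 * real n0"
  have "computes {Arg1, Out, Work} (division_prog n0 h MP SP) n n n n 7 F G (series_quotient n F G)
      ((lam_m * ((c + 1) / 2 + 1 / c) + lam_s * (1 + 1 / c)) * M n + C * real n)"
    if n: "1 \<le> n" and G0: "coeff G 0 dvd 1" for n and F G :: "'k poly"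
  proof -
    let ?q = "fps_nth (unit_quotient (fps_of_poly F) (fps_of_poly G))"
    let ?u = "fps_nth (unit_quotient 1 (fps_of_poly G))"
    have quot: "fps_of_poly G * unit_quotient x (fps_of_poly G) = x" for x
      using unit_quotient_eq[OF fps_of_poly_dvd_1[OF G0]] by blast
    interpret division n "coeff G" "coeff F" ?q
      by unfold_locales (use n G0 quot in \<open>simp_all add: fps_of_poly_def fps_nth_inverse\<close>)
    define K where "K = (if n < n0 then 0 else n div h)"
    have T0: "0 \<le> T n" unfolding T_def
      using m0[OF n] s0[OF n] c h by (intro add_nonneg_nonneg mult_nonneg_nonneg[OF m0[OF n]] mult_nonneg_nonneg[OF s0[OF n]]) auto
    have large: "block_division n (coeff G) (coeff F) ?q ?u h K MP SP wm ws (\<lambda>m. lam_m * M m) (\<lambda>m. lam_s * M m) \<and>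
      K = n div h \<and> lam_m * M K + lam_s * M K + 6 * real K + real h * (lam_s * M K)
        + real h * (real h - 1) / 2 * (lam_m * M K + real K) \<le> T n" if n0: "\<not> n < n0"
    proof -
      have Kn: "K = n div h" using n0 by (simp add: K_def)
      have DK: "D \<le> K" using n0 h4 unfolding Kn n0_def by (simp add: less_eq_div_iff_mult_less_eq mult.commute)
      then have K1: "1 \<le> K" using D(3) by linarith
      have hK: "h * K \<le> n" by (simp add: Kn)
      have "1 * K \<le> h * K" using h4 by (intro mult_le_mono1) auto
      then have Kle: "K \<le> n" using hK by linarith
      have hKr: "(c + 1) * real K \<le> real n"
      proof -
        have "(c + 1) * real K \<le> real h * real K" using h by (intro mult_right_mono) auto
        also have "\<dots> \<le> real n" using hK by (metis of_nat_le_iff of_nat_mult)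
        finally show ?thesis .
      qed
      \<comment> \<open>With \<open>w m <= b * K + K\<close>, the total is at most
        \<open>(b + 3) * K <= (c + 1) * K <= n\<close>.\<close>
      have space: "2 * K + w m \<le> n" if "1 \<le> m" "m \<le> K" "real (w m) \<le> b * real m + d" "0 \<le> b" "b + 2 \<le> c"
        "d \<le> real D" for w :: "nat \<Rightarrow> nat" and m and b d :: real
      proof -
        have "b * real m \<le> b * real K" using that by (intro mult_left_mono) auto
        moreover have "d \<le> real K" using that(6) DK by linarith
        moreover have "(b + 3) * real K \<le> (c + 1) * real K" using that by (intro mult_right_mono) auto
        ultimately have "2 * real K + real (w m) \<le> real n" using that(3) hKr by (simp add: algebra_simps)
        then show ?thesis by linarith
      qed
      have "block_division n (coeff G) (coeff F) ?q ?u h K MP SP wm ws (\<lambda>m. lam_m * M m) (\<lambda>m. lam_s * M m)"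
      proof (unfold_locales, goal_cases)
        case 1
        then show ?case using quot[of 1] by (simp add: fps_of_poly_def fps_nth_inverse)
      next
        case (7 m)
        then show ?case using wm cm c D by (intro space[of m wm cm dm]) auto
      next
        case (8 m)
        then show ?case using ws cs c D by (intro space[of m ws cs ds]) auto
      next
        case (9 m)
        then show ?case using scaled_time_bound[OF assms(1) m0] by auto
      next
        case (10 m)
        then show ?case using scaled_time_bound[OF assms(1) s0] by auto
      qed (use MP SP K1 hK h4 m0 s0 in auto)
      moreover have "lam_m * M K + lam_s * M K + 6 * real K + real h * (lam_s * M K)
        + real h * (real h - 1) / 2 * (lam_m * M K + real K) \<le> T n"
        unfolding T_def
        by (rule division_cost_bound)
          (use m0[OF n] s0[OF n] c(1) h hK K1 scaled_time_bound[OF assms(1) m0 K1 Kle]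
            scaled_time_bound[OF assms(1) s0 K1 Kle] in auto)
      ultimately show ?thesis using Kn by blast
    qed
    \<comment> \<open>Fewer than \<open>h\<close> rows remain after the blocks if \<open>n\<close>
      is large, and there are fewer than \<open>n0\<close> in all if it is small; the sum covers
      both cases.\<close>
    have "(n - h * K) * (2 * n) \<le> (h + n0) * (2 * n)"
    proof (rule mult_le_mono1)
      have "n - h * (n div h) = n mod h" by (simp add: minus_mult_div_eq_mod)
      moreover have "n mod h < h" using h4 by simp
      ultimately show "n - h * K \<le> h + n0" by (simp add: K_def)
    qed
    then have "real ((n - h * K) * (2 * n)) \<le> real ((h + n0) * (2 * n))" using of_nat_mono by blast
    also have "\<dots> = (2 * real h + 2 * real n0) * real n" by (simp add: algebra_simps)
    finally have T: "T n + real ((n - h * K) * (2 * n))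
        \<le> (lam_m * ((c + 1) / 2 + 1 / c) + lam_s * (1 + 1 / c)) * M n + C * real n"
      unfolding T_def C_def by (simp add: algebra_simps)
    show ?thesis
      unfolding computes_def
    proof (intro allI impI)
      fix \<mu> :: "'k mem" assume "holds_poly \<mu> Arg1 n F \<and> holds_poly \<mu> Arg2 n G"
      then have "runs (lay n) (division_prog n0 h MP SP) 0 \<mu> (\<lambda>t' \<mu>'.
          real t' \<le> T n + real ((n - h * K) * (2 * n)) \<and> (\<forall>j<n. \<mu>' (Out, j) = Coef (?q j)))"
        by (intro runs_division[OF _ _ _ large]) (use T0 in \<open>auto simp: holds_poly_def K_def\<close>)
      then obtain t \<mu>' where "exec (lay n) (division_prog n0 h MP SP) \<mu> t \<mu>'"
        "real t \<le> T n + real ((n - h * K) * (2 * n))" "\<forall>j<n. \<mu>' (Out, j) = Coef (?q j)"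
        unfolding runs_def by auto
      then show "\<exists>t \<mu>'. exec \<lparr>psize = n, len = space_lens n n n 7, writable = {Arg1, Out, Work}\<rparr>
          (division_prog n0 h MP SP) \<mu> t \<mu>' \<and> holds_poly \<mu>' Out n (series_quotient n F G) \<and>
          real t \<le> (lam_m * ((c + 1) / 2 + 1 / c) + lam_s * (1 + 1 / c)) * M n + C * real n"
        using T unfolding lay_def
        by (intro exI[of _ t] exI[of _ \<mu>'])
          (auto simp: holds_poly_def series_quotient_def coeff_truncate_fps)
    qed
  qed
  then show ?thesis
    unfolding erasing_division_algorithm_def by blast
qed

end
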